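(* Let $H\supseteq\mathbb{R}$ be a Liouville closed Hardy field and let $A$, $B$ be a wide gap in $H$ with $\operatorname{cf}(A)=\operatorname{ci}(B)=\omega$. Then there exists $y\in\mathcal{C}^{<\infty}$ with $A<_{\mathrm{e}}y<_{\mathrm{e}}B$ that is $H$-hardian.
   Context: $\mathcal{C}^{<\infty}$ is the ring of germs at $+\infty$ of real functions on intervals $[a,+\infty)$ that are $C^n$ for all $n$. $g<_{\mathrm{e}}h$ means $g(t)<h(t)$ eventually; $A<_{\mathrm{e}}y$ means $a<_{\mathrm{e}}y$ for all $a\in A$, and similarly for $y<_{\mathrm{e}}B$. A Hardy field is a subfield of the ring of germs at $+\infty$ of real differentiable functions closed under differentiation, ordered by eventual comparison; $H\supseteq\mathbb{R}$ is Liouville closed if it is real closed and for each $f\in H$ contains $\exp(f)$ and some $g$ with $g'=f$. $y$ is $H$-hardian if it lies in a Hardy field containing $H$. With $H^{>\mathbb{R}}=\{h\in H: h>\mathbb{R}\}$, a wide gap in $H$ is a pair $A,B$ of nonempty subsets of $H^{>\mathbb{R}}$ with $A<B$, such that there is no $h\in H$ with $A<h<B$, and such that $A$ and $\exp A=\{\exp a:a\in A\}$ are cofinal (every element of each is $\le$ some element of the other). $\operatorname{cf}$, $\operatorname{ci}$ denote cofinality and coinitiality. *)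

theory Defs
  imports "HOL-Analysis.Analysis" "HOL-Computational_Algebra.Polynomial"
begin

unbundle cardinal_syntax

section \<open>Germs at infinity\<close>

text \<open>
  A real function on some interval \<open>[a, \<infinity>)\<close> is represented by an arbitrary extension of it to
  the whole real line; the choice does not affect the germ.
\<close>

quotient_type germ = "real \<Rightarrow> real" / "\<lambda>f g. \<forall>\<^sub>F t in at_top. f t = g t"
  morphisms rep_germ germ_of
proof (rule equivpI)
  show "reflp (\<lambda>f g::real \<Rightarrow> real. \<forall>\<^sub>F t in at_top. f t = g t)"
    by (simp add: reflp_def)
  show "symp (\<lambda>f g::real \<Rightarrow> real. \<forall>\<^sub>F t in at_top. f t = g t)"
    by (simp add: symp_def eq_commute)
  show "transp (\<lambda>f g::real \<Rightarrow> real. \<forall>\<^sub>F t in at_top. f t = g t)"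
    by (auto simp: transp_def elim: eventually_elim2)
qed

instantiation germ :: comm_ring_1
begin

lift_definition zero_germ :: germ is "\<lambda>_. 0" .
lift_definition one_germ :: germ is "\<lambda>_. 1" .
lift_definition plus_germ :: "germ \<Rightarrow> germ \<Rightarrow> germ" is "\<lambda>f g t. f t + g t"
  by (auto elim: eventually_elim2)
lift_definition minus_germ :: "germ \<Rightarrow> germ \<Rightarrow> germ" is "\<lambda>f g t. f t - g t"
  by (auto elim: eventually_elim2)
lift_definition uminus_germ :: "germ \<Rightarrow> germ" is "\<lambda>f t. - f t"
  by (auto elim: eventually_mono)
lift_definition times_germ :: "germ \<Rightarrow> germ \<Rightarrow> germ" is "\<lambda>f g t. f t * g t"
  by (auto elim: eventually_elim2)

instance
proof
  show "(0::germ) \<noteq> 1"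
    by transfer (simp add: trivial_limit_at_top_linorder)
qed (transfer; simp add: algebra_simps)+

end

lift_definition germ_const :: "real \<Rightarrow> germ" is "\<lambda>r _. r" .

lift_definition germ_exp :: "germ \<Rightarrow> germ" is "\<lambda>f t. exp (f t)"
  by (auto elim: eventually_mono)

lift_definition germ_less :: "germ \<Rightarrow> germ \<Rightarrow> bool"  (infix \<open><\<^sub>e\<close> 50)
  is "\<lambda>f g. \<forall>\<^sub>F t in at_top. f t < g t"
  by (rule eventually_subst) (auto elim: eventually_elim2)

lift_definition germ_le :: "germ \<Rightarrow> germ \<Rightarrow> bool"  (infix \<open>\<le>\<^sub>e\<close> 50)
  is "\<lambda>f g. \<forall>\<^sub>F t in at_top. f t \<le> g t"
  by (rule eventually_subst) (auto elim: eventually_elim2)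

lemma eventually_at_top_nhds:
  fixes P :: "real \<Rightarrow> bool"
  assumes "\<forall>\<^sub>F t in at_top. P t"
  shows "\<forall>\<^sub>F t in at_top. \<forall>\<^sub>F s in nhds t. P s"
proof -
  from assms obtain a where a: "\<And>t. t > a \<Longrightarrow> P t"
    unfolding eventually_at_top_dense by blast
  have "\<forall>\<^sub>F s in nhds t. P s" if "t > a" for t
    using eventually_nhds_in_open[of "{a<..}" t] that by (auto elim: eventually_mono intro: a)
  then show ?thesis
    unfolding eventually_at_top_dense by blast
qed

lemma has_field_derivative_cong_nhds:
  fixes f g :: "real \<Rightarrow> real"
  assumes "\<forall>\<^sub>F s in nhds t. f s = g s"
  shows "(f has_field_derivative D) (at t) \<longleftrightarrow> (g has_field_derivative D) (at t)"
  using assms by (intro DERIV_cong_ev) auto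

lift_definition germ_differentiable :: "germ \<Rightarrow> bool"
  is "\<lambda>f. \<forall>\<^sub>F t in at_top. f differentiable (at t)"
proof -
  have *: "\<forall>\<^sub>F t in at_top. g differentiable (at t)"
    if "\<forall>\<^sub>F t in at_top. f t = g t" "\<forall>\<^sub>F t in at_top. f differentiable (at t)"
    for f g :: "real \<Rightarrow> real"
    using eventually_at_top_nhds[OF that(1)] that(2)
    by eventually_elim (auto simp: real_differentiable_def has_field_derivative_cong_nhds)
  show "(\<forall>\<^sub>F t in at_top. f differentiable (at t)) \<longleftrightarrow> (\<forall>\<^sub>F t in at_top. g differentiable (at t))"
    if "\<forall>\<^sub>F t in at_top. f t = g t" for f g :: "real \<Rightarrow> real"
    using *[of f g] *[of g f] that by (auto simp: eq_commute)
qed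

text \<open>
  Defined on all germs, but the derivative of \<open>f\<close> only if \<^term>\<open>germ_differentiable f\<close>.
\<close>

lift_definition germ_deriv :: "germ \<Rightarrow> germ" is "deriv"
proof -
  fix f g :: "real \<Rightarrow> real"
  assume "\<forall>\<^sub>F t in at_top. f t = g t"
  from eventually_at_top_nhds[OF this] show "\<forall>\<^sub>F t in at_top. deriv f t = deriv g t"
    by eventually_elim (simp add: deriv_def has_field_derivative_cong_nhds)
qed

text \<open>
  \<open>Cn_on n f S\<close>: \<open>f\<close> is \<open>n\<close> times continuously differentiable on the open set \<open>S\<close>.
\<close>

definition Cn_on :: "nat \<Rightarrow> (real \<Rightarrow> real) \<Rightarrow> real set \<Rightarrow> bool" where
  "Cn_on n f S \<longleftrightarrow>
     (\<forall>k<n. \<forall>t\<in>S. ((deriv ^^ k) f) differentiable (at t)) \<and> continuous_on S ((deriv ^^ n) f)"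

definition germs_Cn :: "nat \<Rightarrow> germ set" where
  "germs_Cn n = {germ_of f | f. \<exists>a. Cn_on n f {a<..}}"

text \<open>
  The interval on which a representative is \<open>C\<^sup>n\<close> may depend on \<open>n\<close>: this is
  \<open>C\<^bsup><\<infinity>\<^esup>\<close>, the intersection of all \<open>C\<^sup>n\<close>, which is strictly larger than the ring
  \<open>C\<^bsup>\<infinity>\<^esup>\<close> of germs of smooth functions.
\<close>

definition germs_C_less_infinity :: "germ set" where
  "germs_C_less_infinity = (\<Inter>n. germs_Cn n)"


section \<open>Hardy fields\<close>

definition subfield_of_germs :: "germ set \<Rightarrow> bool" where
  "subfield_of_germs K \<longleftrightarrow>
     0 \<in> K \<and> 1 \<in> K \<and>
     (\<forall>f\<in>K. \<forall>g\<in>K. f + g \<in> K \<and> f * g \<in> K) \<and>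
     (\<forall>f\<in>K. - f \<in> K) \<and>
     (\<forall>f\<in>K. f \<noteq> 0 \<longrightarrow> (\<exists>g\<in>K. f * g = 1))"

definition hardy_field :: "germ set \<Rightarrow> bool" where
  "hardy_field K \<longleftrightarrow>
     subfield_of_germs K \<and> (\<forall>f\<in>K. germ_differentiable f) \<and> (\<forall>f\<in>K. germ_deriv f \<in> K)"

text \<open>Meaningful for a field of germs on which \<open><\<^sub>e\<close> is a total order, such as a Hardy field.\<close>

definition real_closed :: "germ set \<Rightarrow> bool" where
  "real_closed K \<longleftrightarrow>
     (\<forall>f\<in>K. 0 <\<^sub>e f \<longrightarrow> (\<exists>g\<in>K. g ^ 2 = f)) \<and>
     (\<forall>p::germ poly. (\<forall>i. coeff p i \<in> K) \<and> odd (degree p) \<longrightarrow> (\<exists>x\<in>K. poly p x = 0))"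

text \<open>To be used for Hardy fields that contain the real constants.\<close>

definition liouville_closed :: "germ set \<Rightarrow> bool" where
  "liouville_closed H \<longleftrightarrow>
     real_closed H \<and> (\<forall>f\<in>H. germ_exp f \<in> H \<and> (\<exists>g\<in>H. germ_deriv g = f))"

definition hardian_over :: "germ set \<Rightarrow> germ \<Rightarrow> bool" where
  "hardian_over H y \<longleftrightarrow> (\<exists>K. hardy_field K \<and> H \<subseteq> K \<and> y \<in> K)"


section \<open>Cofinality and wide gaps\<close>

definition cofinal_subset :: "('a \<Rightarrow> 'a \<Rightarrow> bool) \<Rightarrow> 'a set \<Rightarrow> 'a set \<Rightarrow> bool" where
  "cofinal_subset le S C \<longleftrightarrow> C \<subseteq> S \<and> (\<forall>s\<in>S. \<exists>c\<in>C. le s c)"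

text \<open>
  The cofinality is the least cardinality of a cofinal subset; it is specified up to isomorphism
  of cardinal orders.
\<close>

definition has_cofinality :: "('a \<Rightarrow> 'a \<Rightarrow> bool) \<Rightarrow> 'a set \<Rightarrow> 'b rel \<Rightarrow> bool" where
  "has_cofinality le S \<kappa> \<longleftrightarrow>
     (\<exists>C. cofinal_subset le S C \<and> |C| =o \<kappa>) \<and>
     (\<forall>C. cofinal_subset le S C \<longrightarrow> \<kappa> \<le>o |C| )"

definition has_coinitiality :: "('a \<Rightarrow> 'a \<Rightarrow> bool) \<Rightarrow> 'a set \<Rightarrow> 'b rel \<Rightarrow> bool" where
  "has_coinitiality le S \<kappa> \<longleftrightarrow> has_cofinality (\<lambda>x y. le y x) S \<kappa>"

definition mutually_cofinal :: "germ set \<Rightarrow> germ set \<Rightarrow> bool" where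
  "mutually_cofinal A B \<longleftrightarrow>
     (\<forall>a\<in>A. \<exists>b\<in>B. a \<le>\<^sub>e b) \<and> (\<forall>b\<in>B. \<exists>a\<in>A. b \<le>\<^sub>e a)"

definition above_reals :: "germ set \<Rightarrow> germ set" where
  "above_reals H = {h \<in> H. \<forall>r. germ_const r <\<^sub>e h}"

definition wide_gap :: "germ set \<Rightarrow> germ set \<Rightarrow> germ set \<Rightarrow> bool" where
  "wide_gap H A B \<longleftrightarrow>
     A \<noteq> {} \<and> B \<noteq> {} \<and> A \<subseteq> above_reals H \<and> B \<subseteq> above_reals H \<and>
     (\<forall>a\<in>A. \<forall>b\<in>B. a <\<^sub>e b) \<and>
     \<not> (\<exists>h\<in>H. (\<forall>a\<in>A. a <\<^sub>e h) \<and> (\<forall>b\<in>B. h <\<^sub>e b)) \<and>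
     mutually_cofinal A (germ_exp ` A)"

end

theory Submission
  imports Defs "HOL-Library.Countable_Set_Type"
begin

text \<open>
  Fix \<open>\<phi>\<close> in \<open>A\<close>. Inside the gap one constructs functions \<open>z 0, z 1, \<dots>\<close> that all lie between \<open>A\<close>
  and \<open>B\<close>, with \<open>z k' = z k * z (k + 1) * \<phi>'\<close> and with every power of \<open>z (k + 1)\<close> below \<open>z k\<close>. A
  quotient of two elements of \<open>H\<close> has absolute value below an element of \<open>A\<close> or above an element of
  \<open>B\<close>, hence is negligible or dominant with respect to all powers of the \<open>z k\<close>. So every polynomial
  in the \<open>z k\<close> over \<open>H\<close> has a single dominant monomial, the fractions of such polynomials form
  a Hardy field, and \<open>y = z 0\<close> is \<open>H\<close>-hardian.

  With \<open>z k = exp (x k)\<close> the equations read \<open>x k' = exp (x (k + 1)) * \<phi>'\<close>, a monotone system. The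
  \<open>x k\<close> are built on successive intervals: on the \<open>m\<close>-th one \<open>x m\<close> follows an element of \<open>H\<close>
  that lies above \<open>A\<close>, and \<open>x k\<close>, \<open>k < m\<close>, is obtained by integration with a continuous initial
  value. These elements decrease with \<open>m\<close>, so the upper bounds required of \<open>x k\<close> become sharper
  with \<open>m\<close>; each interval is long enough for the current solution to satisfy the bounds of
  the next stage at its end, and monotonicity of the system then preserves them. The function
  \<open>x k\<close> is as smooth as desired on a sufficiently late half-line.
\<close>

section \<open>Hardy fields as sets of functions\<close>

lemma germ_of_rep [simp]: "germ_of (rep_germ x) = x"
  using Quotient_abs_rep[OF Quotient_germ] .

lemma germ_of_eq_iff: "germ_of f = germ_of g \<longleftrightarrow> (\<forall>\<^sub>F t in at_top. f t = g t)"
  using germ.abs_eq_iff .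

text \<open>The difference \<open>g - f\<close> is nondecreasing from some \<open>T\<close> on, so
  \<open>C = f T - g T\<close> works. Inequalities between derivatives are integrated this way; the
  additive constant is absorbed later by functions that tend to infinity.\<close>

lemma bounded_growth_of_deriv_le:
  fixes f g :: "real \<Rightarrow> real"
  assumes "\<forall>\<^sub>F t in at_top. (f has_real_derivative f' t) (at t)"
    and "\<forall>\<^sub>F t in at_top. (g has_real_derivative g' t) (at t)"
    and "\<forall>\<^sub>F t in at_top. f' t \<le> g' t"
  shows "\<exists>C. \<forall>\<^sub>F t in at_top. f t \<le> g t + C"
proof -
  obtain T where T: "\<And>t. t \<ge> T \<Longrightarrow>
      (f has_real_derivative f' t) (at t) \<and> (g has_real_derivative g' t) (at t) \<and> f' t \<le> g' t"
    using eventually_conj[OF assms(1) eventually_conj[OF assms(2,3)]]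
    unfolding eventually_at_top_linorder by blast
  have "f t \<le> g t + (f T - g T)" if "t \<ge> T" for t
  proof -
    have "g T - f T \<le> g t - f t"
    proof (rule DERIV_nonneg_imp_nondecreasing[OF that])
      fix x assume "T \<le> x"
      then have "((\<lambda>t. g t - f t) has_real_derivative g' x - f' x) (at x)" "g' x - f' x \<ge> 0"
        using T[of x] by (auto intro!: derivative_intros)
      then show "\<exists>y. ((\<lambda>t. g t - f t) has_real_derivative y) (at x) \<and> 0 \<le> y"
        by blast
    qed
    then show ?thesis by simp
  qed
  then show ?thesis
    unfolding eventually_at_top_linorder by blast
qed

text \<open>The intermediate value theorem excludes a change of sign. This makes eventual comparison
  a total order on a Hardy field.\<close>

lemma eventually_constant_sign:
  fixes f :: "real \<Rightarrow> real"
  assumes "\<forall>\<^sub>F t in at_top. isCont f t" and "\<forall>\<^sub>F t in at_top. f t \<noteq> 0"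
  shows "(\<forall>\<^sub>F t in at_top. f t > 0) \<or> (\<forall>\<^sub>F t in at_top. f t < 0)"
proof -
  obtain T where T: "\<And>t. t \<ge> T \<Longrightarrow> isCont f t \<and> f t \<noteq> 0"
    using eventually_conj[OF assms] unfolding eventually_at_top_linorder by blast
  have cont: "continuous_on {T..t} f" for t
    using T by (auto intro!: continuous_at_imp_continuous_on)
  have "f T \<noteq> 0"
    using T by blast
  then consider "f T > 0" | "f T < 0"
    by linarith
  then show ?thesis
  proof cases
    case 1
    have "f t > 0" if le: "t \<ge> T" for t
    proof (rule ccontr)
      assume "\<not> f t > 0"
      then obtain x where "T \<le> x" "f x = 0"
        using IVT2'[of f t 0 T] cont[of t] le 1 by (auto simp: not_less)
      then show False using T by blast
    qed
    then show ?thesis unfolding eventually_at_top_linorder by blast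
  next
    case 2
    have "f t < 0" if le: "t \<ge> T" for t
    proof (rule ccontr)
      assume "\<not> f t < 0"
      then obtain x where "T \<le> x" "f x = 0"
        using IVT'[of f T 0 t] cont[of t] le 2 by (auto simp: not_less)
      then show False using T by blast
    qed
    then show ?thesis unfolding eventually_at_top_linorder by blast
  qed
qed

section \<open>Order and closure properties of a Liouville closed Hardy field\<close>

locale liouville_hardy_field =
  fixes H :: "germ set"
  assumes hardy: "hardy_field H"
    and const: "range germ_const \<subseteq> H"
    and liouville: "liouville_closed H"
begin

text \<open>Membership is carried over to representatives, so that derivatives, limits and eventual
  inequalities are handled by ordinary calculus.\<close>

definition inH :: "(real \<Rightarrow> real) \<Rightarrow> bool" where
  "inH f \<longleftrightarrow> germ_of f \<in> H"

lemma inH_rep [simp]: "inH (rep_germ h) \<longleftrightarrow> h \<in> H"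
  by (simp add: inH_def)

lemma inH_cong:
  assumes "inH f" and "\<forall>\<^sub>F t in at_top. f t = g t"
  shows "inH g"
  using assms germ_of_eq_iff[of f g] by (simp add: inH_def)

lemma subfield: "subfield_of_germs H"
  using hardy by (simp add: hardy_field_def)

lemma inH_const [intro]: "inH (\<lambda>_. c)"
  using const by (auto simp: inH_def germ_const.abs_eq[symmetric])

lemma inH_add [intro]: "inH f \<Longrightarrow> inH g \<Longrightarrow> inH (\<lambda>t. f t + g t)"
  using subfield by (simp add: subfield_of_germs_def inH_def flip: plus_germ.abs_eq)

lemma inH_mult [intro]: "inH f \<Longrightarrow> inH g \<Longrightarrow> inH (\<lambda>t. f t * g t)"
  using subfield by (simp add: subfield_of_germs_def inH_def flip: times_germ.abs_eq)

lemma inH_minus [intro]: "inH f \<Longrightarrow> inH (\<lambda>t. - f t)"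
  using subfield by (simp add: subfield_of_germs_def inH_def flip: uminus_germ.abs_eq)

lemma inH_diff [intro]: "inH f \<Longrightarrow> inH g \<Longrightarrow> inH (\<lambda>t. f t - g t)"
  using inH_add[of f "\<lambda>t. - g t"] inH_minus[of g] by simp

lemma inH_exp [intro]: "inH f \<Longrightarrow> inH (\<lambda>t. exp (f t))"
  using liouville by (simp add: liouville_closed_def inH_def flip: germ_exp.abs_eq)

lemma inH_deriv [intro]: "inH f \<Longrightarrow> inH (deriv f)"
  using hardy by (simp add: hardy_field_def inH_def flip: germ_deriv.abs_eq)

lemma inH_has_deriv:
  assumes "inH f"
  shows "\<forall>\<^sub>F t in at_top. (f has_real_derivative deriv f t) (at t)"
proof -
  have "germ_differentiable (germ_of f)"
    using hardy assms unfolding hardy_field_def inH_def by blast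
  then show ?thesis
    unfolding germ_differentiable.abs_eq
    by eventually_elim (simp add: DERIV_deriv_iff_real_differentiable)
qed

lemma inH_isCont:
  assumes "inH f"
  shows "\<forall>\<^sub>F t in at_top. isCont f t"
  using inH_has_deriv[OF assms] by eventually_elim (rule DERIV_isCont)

lemma inH_zero_or_inverse:
  assumes "inH f"
  shows "(\<forall>\<^sub>F t in at_top. f t = 0) \<or> (\<exists>g. inH g \<and> (\<forall>\<^sub>F t in at_top. f t * g t = 1))"
proof (cases "germ_of f = 0")
  case True
  then show ?thesis by (simp add: zero_germ_def germ_of_eq_iff)
next
  case False
  then obtain g where g: "g \<in> H" "germ_of f * g = 1"
    using subfield assms unfolding subfield_of_germs_def inH_def by blast
  have "germ_of (\<lambda>t. f t * rep_germ g t) = germ_of (\<lambda>_. 1)"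
    using g(2) unfolding times_germ.abs_eq[symmetric] one_germ_def by simp
  then show ?thesis
    using g(1) unfolding germ_of_eq_iff by (intro disjI2 exI[of _ "rep_germ g"]) simp
qed

text \<open>A nonzero element has an inverse in the field, so it eventually has no zeros; being
  continuous, it then has constant sign.\<close>

lemma inH_trichotomy:
  assumes "inH f"
  shows "(\<forall>\<^sub>F t in at_top. f t = 0) \<or> (\<forall>\<^sub>F t in at_top. f t > 0) \<or> (\<forall>\<^sub>F t in at_top. f t < 0)"
proof (cases "\<forall>\<^sub>F t in at_top. f t = 0")
  case False
  then obtain g where "\<forall>\<^sub>F t in at_top. f t * g t = 1"
    using inH_zero_or_inverse[OF assms] by blast
  then have "\<forall>\<^sub>F t in at_top. f t \<noteq> 0"
    by eventually_elim auto
  then show ?thesis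
    using eventually_constant_sign[OF inH_isCont[OF assms]] by blast
qed simp

lemma inH_inverse [intro]:
  assumes "inH f"
  shows "inH (\<lambda>t. inverse (f t))"
  using inH_zero_or_inverse[OF assms]
proof
  \<comment> \<open>The convention \<open>inverse 0 = 0\<close> makes the pointwise inverse
    eventually zero here.\<close>
  assume "\<forall>\<^sub>F t in at_top. f t = 0"
  then have "\<forall>\<^sub>F t in at_top. 0 = inverse (f t)"
    by eventually_elim simp
  then show ?thesis by (rule inH_cong[OF inH_const])
next
  assume "\<exists>g. inH g \<and> (\<forall>\<^sub>F t in at_top. f t * g t = 1)"
  then obtain g where g: "inH g" "\<forall>\<^sub>F t in at_top. f t * g t = 1"
    by blast
  from g(2) have "\<forall>\<^sub>F t in at_top. g t = inverse (f t)"
    by eventually_elim (metis inverse_unique)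
  then show ?thesis by (rule inH_cong[OF g(1)])
qed

lemma inH_divide [intro]: "inH f \<Longrightarrow> inH g \<Longrightarrow> inH (\<lambda>t. f t / g t)"
  unfolding divide_inverse by (intro inH_mult inH_inverse)

lemma inH_less_or_ge:
  assumes "inH f" "inH g"
  shows "(\<forall>\<^sub>F t in at_top. f t < g t) \<or> (\<forall>\<^sub>F t in at_top. g t \<le> f t)"
proof -
  consider "\<forall>\<^sub>F t in at_top. f t - g t = 0" | "\<forall>\<^sub>F t in at_top. f t - g t > 0"
    | "\<forall>\<^sub>F t in at_top. f t - g t < 0"
    using inH_trichotomy[OF inH_diff[OF assms]] by blast
  then show ?thesis
  proof cases
    case 1
    then have "\<forall>\<^sub>F t in at_top. g t \<le> f t"
      by eventually_elim simp
    then show ?thesis ..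
  next
    case 2
    then have "\<forall>\<^sub>F t in at_top. g t \<le> f t"
      by eventually_elim simp
    then show ?thesis ..
  next
    case 3
    then have "\<forall>\<^sub>F t in at_top. f t < g t"
      by eventually_elim simp
    then show ?thesis ..
  qed
qed

lemma inH_antiderivative:
  assumes "inH f"
  shows "\<exists>g. inH g \<and> (\<forall>\<^sub>F t in at_top. (g has_real_derivative f t) (at t))"
proof -
  obtain h where h: "h \<in> H" "germ_deriv h = germ_of f"
    using liouville assms unfolding liouville_closed_def inH_def by blast
  have "germ_of (deriv (rep_germ h)) = germ_of f"
    using h(2) unfolding germ_deriv.abs_eq[symmetric] by simp
  then have "\<forall>\<^sub>F t in at_top. deriv (rep_germ h) t = f t"
    by (simp add: germ_of_eq_iff)
  moreover have inH: "inH (rep_germ h)"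
    using h(1) by simp
  moreover note inH_has_deriv[OF inH]
  ultimately have "\<forall>\<^sub>F t in at_top. (rep_germ h has_real_derivative f t) (at t)"
    by (auto elim: eventually_elim2)
  with inH show ?thesis
    by blast
qed

text \<open>An antiderivative of \<open>f'\<close> in \<open>H\<close> differs from \<open>f\<close>
  by a constant on a half-line, and \<open>H\<close> contains the constants. Functions defined by
  integration are shown to lie in \<open>H\<close> this way.\<close>

lemma inH_of_deriv:
  assumes "inH f'" and f: "\<forall>\<^sub>F t in at_top. (f has_real_derivative f' t) (at t)"
  shows "inH f"
proof -
  obtain g where g: "inH g" "\<forall>\<^sub>F t in at_top. (g has_real_derivative f' t) (at t)"
    using inH_antiderivative[OF assms(1)] by blast
  obtain T where T: "\<And>t. t > T \<Longrightarrow>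
      (f has_real_derivative f' t) (at t) \<and> (g has_real_derivative f' t) (at t)"
    using eventually_conj[OF f g(2)] unfolding eventually_at_top_dense by blast
  have "\<exists>c. \<forall>t\<in>{T<..}. f t - g t = c"
  proof (rule has_field_derivative_zero_constant)
    fix t assume "t \<in> {T<..}"
    then have "((\<lambda>t. f t - g t) has_real_derivative f' t - f' t) (at t)"
      using T[of t] by (intro DERIV_diff) auto
    then show "((\<lambda>t. f t - g t) has_real_derivative 0) (at t within {T<..})"
      by (simp add: has_field_derivative_at_within)
  qed simp
  then obtain c where c: "\<And>t. t > T \<Longrightarrow> f t - g t = c"
    by fastforce
  then have "\<And>t. t > T \<Longrightarrow> g t + c = f t"
    by fastforce
  then have "\<forall>\<^sub>F t in at_top. g t + c = f t"
    unfolding eventually_at_top_dense by blast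
  then show ?thesis
    by (rule inH_cong[OF inH_add[OF g(1) inH_const]])
qed

text \<open>Logarithms come from closure under antiderivatives, applied to the logarithmic
  derivative \<open>deriv f t / f t\<close>.\<close>

lemma inH_ln:
  assumes "inH f" and "\<forall>\<^sub>F t in at_top. f t > 0"
  shows "inH (\<lambda>t. ln (f t))"
proof (rule inH_of_deriv)
  show "inH (\<lambda>t. deriv f t / f t)"
    using assms by (intro inH_divide inH_deriv)
  show "\<forall>\<^sub>F t in at_top. ((\<lambda>t. ln (f t)) has_real_derivative deriv f t / f t) (at t)"
    using inH_has_deriv[OF assms(1)] assms(2)
    by eventually_elim (auto intro!: derivative_eq_intros)
qed

text \<open>Otherwise the derivative is eventually nonpositive, by totality of the order, and
  comparison with a constant bounds \<open>f\<close> from above.\<close>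

lemma deriv_pos_of_at_top:
  assumes "inH f" and "filterlim f at_top at_top"
  shows "\<forall>\<^sub>F t in at_top. deriv f t > 0"
proof -
  have "\<not> (\<forall>\<^sub>F t in at_top. deriv f t \<le> 0)"
  proof
    assume "\<forall>\<^sub>F t in at_top. deriv f t \<le> 0"
    then obtain C where "\<forall>\<^sub>F t in at_top. f t \<le> 0 + C"
      using bounded_growth_of_deriv_le[OF inH_has_deriv[OF assms(1)], of "\<lambda>_. 0" "\<lambda>_. 0"] by auto
    moreover have "\<forall>\<^sub>F t in at_top. f t > C"
      using assms(2) by (simp add: filterlim_at_top_dense)
    ultimately have "\<forall>\<^sub>F t::real in at_top. False"
      by eventually_elim simp
    then show False by simp
  qed
  then show ?thesis
    using inH_less_or_ge[OF inH_const[of 0] inH_deriv[OF assms(1)]] by blast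
qed

end

section \<open>Wide gaps in a Liouville closed Hardy field\<close>

locale scaled_hardy_field = liouville_hardy_field +
  fixes \<phi> :: "real \<Rightarrow> real"
  assumes inH_scale [intro, simp]: "inH \<phi>"
    and scale_at_top: "filterlim \<phi> at_top at_top"
begin

lemma deriv_scale_pos: "\<forall>\<^sub>F t in at_top. deriv \<phi> t > 0"
  using deriv_pos_of_at_top[OF inH_scale scale_at_top] .

text \<open>For the system \<open>x k' = exp (x (k + 1)) * \<phi>'\<close> this operation recovers
  \<open>x (k + 1)\<close> from \<open>x k\<close>.\<close>

definition log_rate :: "(real \<Rightarrow> real) \<Rightarrow> real \<Rightarrow> real" where
  "log_rate h t = ln (deriv h t / deriv \<phi> t)"

lemma exp_log_rate:
  assumes "inH h" and "filterlim h at_top at_top"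
  shows "\<forall>\<^sub>F t in at_top. exp (log_rate h t) * deriv \<phi> t = deriv h t"
  using deriv_pos_of_at_top[OF assms] deriv_scale_pos
  by eventually_elim (simp add: log_rate_def)

lemma has_deriv_log_rate:
  assumes "inH h" and "filterlim h at_top at_top"
  shows "\<forall>\<^sub>F t in at_top. (h has_real_derivative exp (log_rate h t) * deriv \<phi> t) (at t)"
  using exp_log_rate[OF assms] inH_has_deriv[OF assms(1)] by eventually_elim simp

lemma inH_log_rate:
  assumes "inH h" and "filterlim h at_top at_top"
  shows "inH (log_rate h)"
proof -
  have "\<forall>\<^sub>F t in at_top. deriv h t / deriv \<phi> t > 0"
    using deriv_pos_of_at_top[OF assms] deriv_scale_pos by eventually_elim simp
  then have "inH (\<lambda>t. ln (deriv h t / deriv \<phi> t))"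
    by (intro inH_ln inH_divide inH_deriv assms(1) inH_scale)
  then show ?thesis
    by (simp add: log_rate_def[abs_def])
qed

text \<open>
  The function \<open>\<phi> + q exp (- h / q)\<close> tends to infinity, so its derivative is eventually positive.
\<close>

lemma log_rate_less:
  assumes h: "inH h" "filterlim h at_top at_top"
  shows "\<forall>\<^sub>F t in at_top. real p * log_rate h t < h t"
proof (cases "p = 0")
  case True
  then show ?thesis
    using h(2) by (simp add: filterlim_at_top_dense)
next
  case False
  define u where "u = (\<lambda>t. \<phi> t + p * exp (- h t / p))"
  have "inH (\<lambda>t. - h t / p)"
    using h(1) by (intro inH_divide inH_minus inH_const)
  then have "inH u"
    unfolding u_def by (intro inH_add inH_mult inH_exp inH_const inH_scale)
  moreover have "filterlim u at_top at_top"
    using scale_at_top by (rule filterlim_at_top_mono) (simp add: u_def)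
  ultimately have "\<forall>\<^sub>F t in at_top. deriv u t > 0"
    by (rule deriv_pos_of_at_top)
  then show ?thesis
    using inH_has_deriv[OF h(1)] inH_has_deriv[OF inH_scale] deriv_scale_pos
      deriv_pos_of_at_top[OF h]
  proof eventually_elim
    case (elim t)
    have "(u has_real_derivative deriv \<phi> t + p * (exp (- h t / p) * (- deriv h t / p))) (at t)"
      unfolding u_def using elim False by (auto intro!: derivative_eq_intros)
    then have "deriv u t = deriv \<phi> t - exp (- h t / p) * deriv h t"
      using False by (simp add: DERIV_imp_deriv)
    then have "exp (- (h t / p)) * deriv h t < deriv \<phi> t"
      using elim by simp
    then have "deriv h t / deriv \<phi> t < exp (h t / p)"
      using elim by (simp add: exp_minus field_simps)
    then have "ln (deriv h t / deriv \<phi> t) < h t / p"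
      using elim by (metis divide_pos_pos exp_gt_zero ln_exp ln_less_cancel_iff)
    then show ?case
      using False by (simp add: log_rate_def field_simps)
  qed
qed

end

section \<open>Elementary growth estimates for \<open>exp\<close> and \<open>ln\<close>\<close>

lemma exp_exp_dominates: "\<forall>\<^sub>F x in at_top. x * exp x + C \<le> exp (exp (x::real))"
proof -
  have "\<forall>\<^sub>F x::real in at_top. x \<ge> max 4 C"
    by (rule eventually_ge_at_top)
  then show ?thesis
  proof eventually_elim
    case (elim x)
    define w where "w = exp x"
    have exp_ge: "1 + v + v\<^sup>2 / 2 \<le> exp v" if "v \<ge> 0" for v :: real
      using exp_lower_Taylor_quadratic[OF that] by simp
    \<comment> \<open>The threshold 4 gives \<open>x\<^sup>2 / 2 \<ge> 2 * x\<close>, hence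
      \<open>w \<ge> 2 * x\<close> and \<open>x * w \<le> w\<^sup>2 / 2\<close>; the linear term of
      the Taylor bound for \<open>exp w\<close> absorbs \<open>C\<close>.\<close>
    have "4 * x \<le> x * x"
      using elim by (intro mult_right_mono) auto
    then have "w \<ge> 2 * x"
      unfolding w_def using exp_ge[of x, unfolded power2_eq_square] elim by linarith
    then have "2 * x * w \<le> w * w"
      using elim by (intro mult_right_mono) (auto simp: w_def)
    then have "x * w + C \<le> 1 + w + w\<^sup>2 / 2"
      using elim \<open>w \<ge> 2 * x\<close> unfolding power2_eq_square by linarith
    then show ?case
      using exp_ge[of w] by (simp add: w_def)
  qed
qed

text \<open>Since \<open>ln x = 2 * ln (sqrt x) < 2 * sqrt x\<close>, it is enough that
  \<open>sqrt x > 2 * p\<close>, whence the threshold \<open>4 * p ^ 2 + 1\<close>. Exponentiated,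
  this says that powers grow slower than \<open>exp\<close>.\<close>

lemma eventually_scaled_ln_less: "\<forall>\<^sub>F x in at_top. real p * ln x < x"
proof -
  have "\<forall>\<^sub>F x::real in at_top. x \<ge> 4 * real p ^ 2 + 1"
    by (rule eventually_ge_at_top)
  then show ?thesis
  proof eventually_elim
    case (elim x)
    have x: "x \<ge> 1"
      using elim by (smt (verit) zero_le_power2)
    have "ln x = 2 * ln (sqrt x)"
      using x by (simp add: ln_sqrt)
    also have "\<dots> < 2 * sqrt x"
      using x ln_less_self[of "sqrt x"] by simp
    finally have "real p * ln x \<le> real p * (2 * sqrt x)"
      by (intro mult_left_mono) auto
    also have "\<dots> = (2 * real p) * sqrt x"
      by simp
    also have "\<dots> < sqrt x * sqrt x"
    proof (intro mult_strict_right_mono)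
      have "(2 * real p)\<^sup>2 < x"
        using elim by (simp add: power_mult_distrib)
      then show "2 * real p < sqrt x"
        by (rule real_less_rsqrt)
    qed (use x in auto)
    finally show ?case
      using x by simp
  qed
qed

section \<open>The two sides of a wide gap\<close>

locale wide_gap_field = liouville_hardy_field +
  fixes A B :: "germ set" and \<phi> :: "real \<Rightarrow> real"
  assumes gap: "wide_gap H A B" and scale: "germ_of \<phi> \<in> A"
begin

definition inA :: "(real \<Rightarrow> real) \<Rightarrow> bool" where
  "inA f \<longleftrightarrow> germ_of f \<in> A"

lemma above_realsD:
  assumes "germ_of f \<in> above_reals H"
  shows "inH f" and "filterlim f at_top at_top"
proof -
  show "inH f"
    using assms by (simp add: above_reals_def inH_def)
  show "filterlim f at_top at_top"
    unfolding filterlim_at_top_dense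
  proof
    fix r
    have "germ_const r <\<^sub>e germ_of f"
      using assms by (simp add: above_reals_def)
    then show "\<forall>\<^sub>F t in at_top. r < f t"
      by (simp add: germ_const.abs_eq germ_less.abs_eq)
  qed
qed

lemma inA_imp:
  assumes "inA f"
  shows inA_inH: "inH f" and inA_at_top: "filterlim f at_top at_top"
  using above_realsD[of f] assms gap by (auto simp: inA_def wide_gap_def)

sublocale scaled_hardy_field H \<phi>
  using inA_imp[of \<phi>] scale by unfold_locales (auto simp: inA_def)

text \<open>The upper side of the cut in \<open>H\<close>. \<open>B\<close> is coinitial in it by
  \<open>above_ge_inB\<close>, every other element of \<open>H\<close> is bounded by an element of
  \<open>A\<close>, and it is closed under \<open>ln\<close> and \<open>log_rate\<close>, which is
  not assumed of \<open>B\<close>.\<close>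

definition above :: "(real \<Rightarrow> real) \<Rightarrow> bool" where
  "above u \<longleftrightarrow> inH u \<and> (\<forall>a. inA a \<longrightarrow> (\<forall>\<^sub>F t in at_top. a t < u t))"

lemma above_inH: "above u \<Longrightarrow> inH u"
  by (simp add: above_def)

lemma above_less: "above u \<Longrightarrow> inA a \<Longrightarrow> \<forall>\<^sub>F t in at_top. a t < u t"
  by (simp add: above_def)

lemma inA_scale: "inA \<phi>"
  using scale by (simp add: inA_def)

lemma above_at_top:
  assumes "above u"
  shows "filterlim u at_top at_top"
proof (rule filterlim_at_top_mono[OF scale_at_top])
  show "\<forall>\<^sub>F t in at_top. \<phi> t \<le> u t"
    using above_less[OF assms inA_scale] by eventually_elim simp
qed

lemma not_aboveD:
  assumes "inH u" and "\<not> above u"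
  shows "\<exists>a. inA a \<and> (\<forall>\<^sub>F t in at_top. u t \<le> a t)"
  using assms inH_less_or_ge[OF inA_inH assms(1)] unfolding above_def by blast

lemma inA_exp_le:
  assumes "inA a"
  shows "\<exists>a'. inA a' \<and> (\<forall>\<^sub>F t in at_top. exp (a t) \<le> a' t)"
proof -
  have "germ_exp (germ_of a) \<in> germ_exp ` A"
    using assms by (simp add: inA_def)
  then obtain g where g: "g \<in> A" "germ_exp (germ_of a) \<le>\<^sub>e g"
    using gap unfolding wide_gap_def mutually_cofinal_def by blast
  have "germ_of (\<lambda>t. exp (a t)) \<le>\<^sub>e germ_of (rep_germ g)"
    using g(2) by (simp add: germ_exp.abs_eq)
  then show ?thesis
    using g(1) unfolding germ_le.abs_eq by (intro exI[of _ "rep_germ g"]) (simp add: inA_def)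
qed

lemma inA_exp_exp_le:
  assumes "inA a"
  shows "\<exists>a'. inA a' \<and> (\<forall>\<^sub>F t in at_top. exp (exp (a t)) \<le> a' t)"
proof -
  obtain a1 where a1: "inA a1" "\<forall>\<^sub>F t in at_top. exp (a t) \<le> a1 t"
    using inA_exp_le[OF assms] by blast
  obtain a2 where a2: "inA a2" "\<forall>\<^sub>F t in at_top. exp (a1 t) \<le> a2 t"
    using inA_exp_le[OF a1(1)] by blast
  have "\<forall>\<^sub>F t in at_top. exp (exp (a t)) \<le> a2 t"
    using a1(2) a2(2) by eventually_elim (meson exp_le_cancel_iff order_trans)
  then show ?thesis using a2(1) by blast
qed

lemma inA_upper_bound2:
  assumes "inA a" "inA b"
  shows "\<exists>c. inA c \<and> (\<forall>\<^sub>F t in at_top. a t \<le> c t) \<and> (\<forall>\<^sub>F t in at_top. b t \<le> c t)"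
proof -
  consider "\<forall>\<^sub>F t in at_top. a t < b t" | "\<forall>\<^sub>F t in at_top. b t \<le> a t"
    using inH_less_or_ge[OF inA_inH[OF assms(1)] inA_inH[OF assms(2)]] by blast
  then show ?thesis
  proof cases
    case 1
    have "\<forall>\<^sub>F t in at_top. a t \<le> b t"
      using 1 by eventually_elim simp
    then show ?thesis using assms(2) by (intro exI[of _ b]) simp
  next
    case 2
    then show ?thesis using assms(1) by (intro exI[of _ a]) simp
  qed
qed

text \<open>Cofinality of \<open>A\<close> and \<open>exp A\<close>, read on the other side of the
  gap: from \<open>exp a \<le> a' < u\<close> follows \<open>a < ln u\<close>.\<close>

lemma above_ln:
  assumes "above u"
  shows "above (\<lambda>t. ln (u t))"
  unfolding above_def
proof (intro conjI allI impI)
  have pos: "\<forall>\<^sub>F t in at_top. u t > 0"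
    using above_at_top[OF assms] by (simp add: filterlim_at_top_dense)
  then show "inH (\<lambda>t. ln (u t))"
    by (intro inH_ln above_inH[OF assms])
  fix a assume "inA a"
  then obtain a' where a': "inA a'" "\<forall>\<^sub>F t in at_top. exp (a t) \<le> a' t"
    using inA_exp_le by blast
  show "\<forall>\<^sub>F t in at_top. a t < ln (u t)"
    using a'(2) above_less[OF assms a'(1)] pos
    by eventually_elim (smt (verit) exp_gt_zero ln_exp ln_less_cancel_iff)
qed

text \<open>
  If \<open>log_rate u \<le> a\<close> with \<open>a \<ge> \<phi>\<close> in \<open>A\<close>, then \<open>u' \<le> exp a * \<phi>' \<le> (exp a * \<phi>)'\<close>, so
  \<open>u\<close> is dominated by \<open>exp (exp a)\<close>.
\<close>

lemma above_log_rate: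
  assumes "above u"
  shows "above (log_rate u)"
proof (rule ccontr)
  note u = above_inH[OF assms] above_at_top[OF assms]
  assume "\<not> above (log_rate u)"
  then obtain a0 where a0: "inA a0" "\<forall>\<^sub>F t in at_top. log_rate u t \<le> a0 t"
    using not_aboveD[OF inH_log_rate[OF u]] by blast
  obtain a where a: "inA a" "\<forall>\<^sub>F t in at_top. a0 t \<le> a t" "\<forall>\<^sub>F t in at_top. \<phi> t \<le> a t"
    using inA_upper_bound2[OF a0(1) inA_scale] by blast
  have ea: "inH (\<lambda>t. exp (a t) * \<phi> t)"
    using inA_inH[OF a(1)] by (intro inH_mult inH_exp inH_scale)
  have \<phi>pos: "\<forall>\<^sub>F t in at_top. \<phi> t > 0"
    using scale_at_top by (simp add: filterlim_at_top_dense)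
  have d1: "\<forall>\<^sub>F t in at_top. ((\<lambda>t. exp (a t) * \<phi> t) has_real_derivative
          exp (a t) * deriv a t * \<phi> t + exp (a t) * deriv \<phi> t) (at t)"
    using inH_has_deriv[OF inA_inH[OF a(1)]] inH_has_deriv[OF inH_scale]
    by eventually_elim (auto intro!: derivative_eq_intros)
  have d2: "\<forall>\<^sub>F t in at_top. exp (log_rate u t) * deriv \<phi> t \<le>
      exp (a t) * deriv a t * \<phi> t + exp (a t) * deriv \<phi> t"
    using a0(2) a(2) deriv_scale_pos deriv_pos_of_at_top[OF inA_imp[OF a(1)]] \<phi>pos
  proof eventually_elim
    case (elim t)
    then have "exp (log_rate u t) * deriv \<phi> t \<le> exp (a t) * deriv \<phi> t"
      by (intro mult_right_mono) auto
    moreover have "exp (a t) * deriv a t * \<phi> t \<ge> 0"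
      using elim by simp
    ultimately show ?case by linarith
  qed
  obtain a' where a': "inA a'" "\<forall>\<^sub>F t in at_top. exp (exp (a t)) \<le> a' t"
    using inA_exp_exp_le[OF a(1)] by blast
  \<comment> \<open>Since \<open>\<phi> \<le> a\<close>, the bound is at most
    \<open>a * exp a + C\<close>, hence below \<open>exp (exp a)\<close>, which some element of
    \<open>A\<close> majorizes; this contradicts \<open>above u\<close>.\<close>
  obtain C where "\<forall>\<^sub>F t in at_top. u t \<le> exp (a t) * \<phi> t + C"
    using bounded_growth_of_deriv_le[OF has_deriv_log_rate[OF u] d1 d2] by blast
  moreover have "\<forall>\<^sub>F t in at_top. a t * exp (a t) + C \<le> exp (exp (a t))"
    using eventually_compose_filterlim[OF exp_exp_dominates inA_at_top[OF a(1)]] .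
  moreover note a'(2) a(3) above_less[OF assms a'(1)]
  ultimately have "\<forall>\<^sub>F t::real in at_top. False"
  proof eventually_elim
    case (elim t)
    have "exp (a t) * \<phi> t \<le> a t * exp (a t)"
      using elim by (subst mult.commute) (intro mult_right_mono, auto)
    then show ?case
      using elim by linarith
  qed
  then show False by simp
qed

lemma inB_above:
  assumes "b \<in> B"
  shows "above (rep_germ b)"
  unfolding above_def
proof (intro conjI allI impI)
  show "inH (rep_germ b)"
    using gap assms by (auto simp: wide_gap_def above_reals_def)
  fix a assume "inA a"
  then have "germ_of a <\<^sub>e germ_of (rep_germ b)"
    using gap assms by (simp add: wide_gap_def inA_def)
  then show "\<forall>\<^sub>F t in at_top. a t < rep_germ b t"
    by (simp add: germ_less.abs_eq del: germ_of_rep)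
qed

lemma above_lower_bound:
  assumes "finite I" and "\<And>i. i \<in> I \<Longrightarrow> above (u i)"
  shows "\<exists>v. above v \<and> (\<forall>i\<in>I. \<forall>\<^sub>F t in at_top. v t \<le> u i t)"
  using assms
proof (induction I rule: finite_induct)
  case empty
  then show ?case
    using gap inB_above by (auto simp: wide_gap_def)
next
  case (insert i I)
  then obtain v where v: "above v" "\<forall>j\<in>I. \<forall>\<^sub>F t in at_top. v t \<le> u j t"
    by blast
  have i: "above (u i)"
    using insert.prems by blast
  consider "\<forall>\<^sub>F t in at_top. v t < u i t" | "\<forall>\<^sub>F t in at_top. u i t \<le> v t"
    using inH_less_or_ge[OF above_inH[OF v(1)] above_inH[OF i]] by blast
  then show ?case
  proof cases
    case 1
    have "\<forall>\<^sub>F t in at_top. v t \<le> u i t"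
      using 1 by eventually_elim simp
    then show ?thesis using v by (intro exI[of _ v]) simp
  next
    case 2
    have "\<forall>\<^sub>F t in at_top. u i t \<le> u j t" if "j \<in> I" for j
      using v(2)[rule_format, OF that] 2 by eventually_elim simp
    then show ?thesis using i by (intro exI[of _ "u i"]) simp
  qed
qed

text \<open>Otherwise \<open>u\<close> would lie strictly below all of \<open>B\<close>, by totality
  of the order on \<open>H\<close>, and would fill the gap.\<close>

lemma above_ge_inB:
  assumes "above u"
  shows "\<exists>b\<in>B. \<forall>\<^sub>F t in at_top. rep_germ b t \<le> u t"
proof (rule ccontr)
  assume *: "\<not> ?thesis"
  have "germ_of u <\<^sub>e b" if "b \<in> B" for b
  proof -
    have "\<forall>\<^sub>F t in at_top. u t < rep_germ b t"
      using * that inH_less_or_ge[OF above_inH[OF assms] above_inH[OF inB_above[OF that]]] by blast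
    then have "germ_of u <\<^sub>e germ_of (rep_germ b)"
      by (simp add: germ_less.abs_eq del: germ_of_rep)
    then show ?thesis by simp
  qed
  moreover have "a <\<^sub>e germ_of u" if "a \<in> A" for a
  proof -
    have "germ_of (rep_germ a) <\<^sub>e germ_of u"
      using above_less[OF assms, of "rep_germ a"] that
      by (simp add: germ_less.abs_eq inA_def del: germ_of_rep) simp
    then show ?thesis by simp
  qed
  ultimately show False
    using gap above_inH[OF assms] by (auto simp: wide_gap_def inH_def)
qed

lemma above_ln_scaled:
  assumes "above u"
  shows "\<forall>\<^sub>F t in at_top. real p * ln (u t) < u t"
  using eventually_compose_filterlim[OF eventually_scaled_ln_less above_at_top[OF assms]] .

end

section \<open>Piecewise construction of the solution\<close>

lemma has_real_derivative_within_atLeast: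
  fixes f :: "real \<Rightarrow> real"
  assumes "(f has_real_derivative D) (at s within {t..})" and "t < s"
  shows "(f has_real_derivative D) (at s)"
  using assms at_within_interior[of s "{t..}"] by simp

lemma nondecreasing_from_initial:
  fixes f :: "real \<Rightarrow> real"
  assumes deriv: "\<And>s. s \<ge> t \<Longrightarrow> (f has_real_derivative f' s) (at s within {t..})"
    and nonneg: "\<And>s. s \<ge> t \<Longrightarrow> f' s \<ge> 0" and "s \<ge> t"
  shows "f t \<le> f s"
proof (rule DERIV_nonneg_imp_increasing_open[OF \<open>s \<ge> t\<close>])
  show "\<exists>y. (f has_real_derivative y) (at x) \<and> 0 \<le> y" if "t < x" "x < s" for x
    using has_real_derivative_within_atLeast[OF deriv[of x]] nonneg[of x] that by auto
  have "continuous_on {t..} f"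
    using deriv by (intro DERIV_continuous_on) auto
  then show "continuous_on {t..s} f"
    by (rule continuous_on_subset) auto
qed

text \<open>Difference quotients are compared on each side separately. At the start of an interval
  of the construction the new piece \<open>h\<close> has only a right derivative.\<close>

lemma has_real_derivative_glue:
  fixes f g h :: "real \<Rightarrow> real"
  assumes g: "(g has_real_derivative D) (at s)" and h: "(h has_real_derivative D) (at s within {s..})"
    and left: "\<forall>\<^sub>F y in at_left s. g y = f y" and right: "\<forall>\<^sub>F y in at_right s. h y = f y"
    and s: "g s = f s" "h s = f s"
  shows "(f has_real_derivative D) (at s)"
proof -
  have "(g has_real_derivative D) (at_left s)"
    using g by (rule has_field_derivative_at_within)
  then have "((\<lambda>y. (g y - g s) / (y - s)) \<longlongrightarrow> D) (at_left s)"
    by (simp add: has_field_derivative_iff)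
  then have l: "((\<lambda>y. (f y - f s) / (y - s)) \<longlongrightarrow> D) (at_left s)"
    by (rule Lim_transform_eventually) (use left s in \<open>auto elim: eventually_mono\<close>)
  have "(h has_real_derivative D) (at_right s)"
    using h by (rule has_field_derivative_subset) auto
  then have "((\<lambda>y. (h y - h s) / (y - s)) \<longlongrightarrow> D) (at_right s)"
    by (simp add: has_field_derivative_iff)
  then have r: "((\<lambda>y. (f y - f s) / (y - s)) \<longlongrightarrow> D) (at_right s)"
    by (rule Lim_transform_eventually) (use right s in \<open>auto elim: eventually_mono\<close>)
  show ?thesis
    using filterlim_split_at[OF l r] by (simp add: has_field_derivative_iff)
qed

lemma integral_has_real_derivative_atLeast:
  fixes f :: "real \<Rightarrow> real"
  assumes "continuous_on {t..} f" and "s \<ge> t"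
  shows "((\<lambda>x. integral {t..x} f) has_real_derivative f s) (at s within {t..})"
proof -
  have "continuous_on {t..s + 1} f"
    using assms(1) by (rule continuous_on_subset) auto
  then have "((\<lambda>x. integral {t..x} f) has_real_derivative f s) (at s within {t..s + 1})"
    using assms(2) by (intro integral_has_real_derivative) auto
  moreover have "at s within {t..s + 1} = at s within {t..}"
    by (rule at_within_nhd[of s "{..<s + 1}"]) auto
  ultimately show ?thesis by simp
qed

text \<open>The system is triangular: once the top component \<open>f\<close> is prescribed, each
  lower component is one integral of the exponential of the next, with free initial value
  \<open>c k\<close>.\<close>

lemma exponential_flow_exists:
  fixes f g :: "real \<Rightarrow> real" and c :: "nat \<Rightarrow> real"
  assumes "continuous_on {t..} f" and g: "continuous_on {t..} g"
  shows "\<exists>X. X m = f \<and> (\<forall>k<m. X k t = c k) \<and>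
    (\<forall>k<m. \<forall>s\<ge>t. (X k has_real_derivative exp (X (Suc k) s) * g s) (at s within {t..}))"
  using assms(1)
proof (induction m arbitrary: f)
  case 0
  show ?case by (intro exI[of _ "\<lambda>_. f"]) simp
next
  case (Suc m)
  define h where "h = (\<lambda>s. c m + integral {t..s} (\<lambda>u. exp (f u) * g u))"
  have "continuous_on {t..} (\<lambda>u. exp (f u) * g u)"
    using Suc.prems g by (intro continuous_intros)
  from integral_has_real_derivative_atLeast[OF this]
  have h: "(h has_real_derivative exp (f s) * g s) (at s within {t..})" if "s \<ge> t" for s
    unfolding h_def using that by (auto intro!: derivative_eq_intros)
  then have "continuous_on {t..} h"
    by (intro DERIV_continuous_on) auto
  from Suc.IH[OF this] obtain X where X: "X m = h" "\<forall>k<m. X k t = c k"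
    "\<forall>k<m. \<forall>s\<ge>t. (X k has_real_derivative exp (X (Suc k) s) * g s) (at s within {t..})"
    by blast
  have ht: "h t = c m"
    by (simp add: h_def)
  show ?case
    using X h ht by (intro exI[of _ "X(Suc m := f)"]) (auto simp: less_Suc_eq)
qed

section \<open>Countable gaps: upper bounds and control functions\<close>

locale countable_wide_gap_field = wide_gap_field +
  fixes a b :: "nat \<Rightarrow> real \<Rightarrow> real"
  assumes inA_a: "\<And>j. inA (a j)"
    and cofinal_a: "\<And>u. inA u \<Longrightarrow> \<exists>j. \<forall>\<^sub>F t in at_top. u t \<le> a j t"
    and above_b: "\<And>j. above (b j)"
    and coinitial_b: "\<And>u. above u \<Longrightarrow> \<exists>j. \<forall>\<^sub>F t in at_top. b j t \<le> u t"
begin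

text \<open>With \<open>z k = exp (\<xi> j k)\<close>, the functions \<open>z k\<close> are the iterated logarithmic derivatives, with
  respect to the derivation scaled by \<open>1 / \<phi>'\<close>, of \<open>z 0 = b j\<close>.\<close>

primrec \<xi> :: "nat \<Rightarrow> nat \<Rightarrow> real \<Rightarrow> real" where
  "\<xi> j 0 = (\<lambda>t. ln (b j t))"
| "\<xi> j (Suc k) = log_rate (\<xi> j k)"

lemma above_\<xi>: "above (\<xi> j k)"
  by (induction k) (auto intro: above_ln above_b above_log_rate)

lemma has_deriv_\<xi>:
  "\<forall>\<^sub>F t in at_top. (\<xi> j k has_real_derivative exp (\<xi> j (Suc k) t) * deriv \<phi> t) (at t)"
  using has_deriv_log_rate[OF above_inH above_at_top, OF above_\<xi> above_\<xi>] by simp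

text \<open>The witness is \<open>ln w\<close> for a common lower bound \<open>w\<close>:
  \<open>ln w \<le> w - 1\<close> gives the margin, and \<open>p * ln w < w\<close> the domination
  for all \<open>p\<close>.\<close>

lemma above_strict_lower_bound:
  assumes "finite I" and "\<And>i. i \<in> I \<Longrightarrow> above (u i)"
  shows "\<exists>v. above v \<and> (\<forall>i\<in>I. \<forall>\<^sub>F t in at_top. v t \<le> u i t - 1) \<and>
    (\<forall>i\<in>I. \<forall>p. \<forall>\<^sub>F t in at_top. real p * v t < u i t)"
proof -
  obtain w where w: "above w" "\<And>i. i \<in> I \<Longrightarrow> \<forall>\<^sub>F t in at_top. w t \<le> u i t"
    using above_lower_bound[of I u] assms by blast
  have pos: "\<forall>\<^sub>F t in at_top. w t > 0"
    using above_at_top[OF w(1)] by (simp add: filterlim_at_top_dense)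
  have "\<forall>\<^sub>F t in at_top. ln (w t) \<le> u i t - 1" if "i \<in> I" for i
    using pos w(2)[OF that] by eventually_elim (use ln_le_minus_one in fastforce)
  moreover have "\<forall>\<^sub>F t in at_top. real p * ln (w t) < u i t" if "i \<in> I" for i p
    using above_ln_scaled[OF w(1), of p] w(2)[OF that] by eventually_elim simp
  ultimately show ?thesis
    using above_ln[OF w(1)] by (intro exI[of _ "\<lambda>t. ln (w t)"]) blast
qed

text \<open>Dependent choice of the top components for the successive stages. The margin below
  \<open>\<xi> j m\<close> is what integration can propagate to lower components; the factor
  \<open>Suc m\<close> provides the domination required when stage \<open>Suc m\<close>
  begins.\<close>

lemma controls_exist:
  "\<exists>f. \<forall>m. (above (f m) \<and> (\<forall>j\<le>m. \<forall>\<^sub>F t in at_top. f m t \<le> \<xi> j m t - 1)) \<and>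
     (\<forall>\<^sub>F t in at_top. real (Suc m) * f (Suc m) t < f m t)"
proof -
  let ?P = "\<lambda>m f. above f \<and> (\<forall>j\<le>m. \<forall>\<^sub>F t in at_top. f t \<le> \<xi> j m t - 1)"
  have "\<exists>f. ?P 0 f"
    using above_strict_lower_bound[of "{..0}" "\<lambda>j. \<xi> j 0"] above_\<xi>[of _ 0] by auto
  moreover have "\<exists>f'. ?P (Suc m) f' \<and> (\<forall>\<^sub>F t in at_top. real (Suc m) * f' t < f t)"
    if f: "?P m f" for m f
  proof -
    \<comment> \<open>The previous control \<open>f\<close> is put at the spare index
      \<open>Suc (Suc m)\<close>, so that one common lower bound serves both requirements.\<close>
    define u where "u = (\<lambda>j. if j \<le> Suc m then \<xi> j (Suc m) else f)"
    have "above (u j)" for j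
      using above_\<xi>[of j "Suc m"] f by (simp add: u_def del: \<xi>.simps)
    then obtain f' where f': "above f'"
      "\<And>j. j \<le> Suc (Suc m) \<Longrightarrow> \<forall>\<^sub>F t in at_top. f' t \<le> u j t - 1"
      "\<And>j p. j \<le> Suc (Suc m) \<Longrightarrow> \<forall>\<^sub>F t in at_top. real p * f' t < u j t"
      using above_strict_lower_bound[of "{..Suc (Suc m)}" u] by auto
    have "\<forall>j\<le>Suc m. \<forall>\<^sub>F t in at_top. f' t \<le> \<xi> j (Suc m) t - 1"
    proof (intro allI impI)
      fix j assume "j \<le> Suc m"
      then show "\<forall>\<^sub>F t in at_top. f' t \<le> \<xi> j (Suc m) t - 1"
        using f'(2)[of j] by (simp add: u_def del: \<xi>.simps)
    qed
    moreover have "\<forall>\<^sub>F t in at_top. real (Suc m) * f' t < f t"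
      using f'(3)[of "Suc (Suc m)" "Suc m"] by (simp add: u_def)
    ultimately show ?thesis
      using f'(1) by blast
  qed
  ultimately show ?thesis
    using dependent_nat_choice[of ?P "\<lambda>m f f'. \<forall>\<^sub>F t in at_top. real (Suc m) * f' t < f t"] by blast
qed

section \<open>Stages of the construction\<close>

definition ctl :: "nat \<Rightarrow> real \<Rightarrow> real" where
  "ctl = (SOME f. \<forall>m. (above (f m) \<and> (\<forall>j\<le>m. \<forall>\<^sub>F t in at_top. f m t \<le> \<xi> j m t - 1)) \<and>
     (\<forall>\<^sub>F t in at_top. real (Suc m) * f (Suc m) t < f m t))"

lemma above_ctl: "above (ctl m)"
  and ctl_le_\<xi>: "j \<le> m \<Longrightarrow> \<forall>\<^sub>F t in at_top. ctl m t \<le> \<xi> j m t - 1"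
  and ctl_Suc_less: "\<forall>\<^sub>F t in at_top. real (Suc m) * ctl (Suc m) t < ctl m t"
  using someI_ex[OF controls_exist] unfolding ctl_def by blast+

text \<open>What must hold pointwise from the start of stage \<open>m\<close>. The bound on
  \<open>deriv (ctl m)\<close> starts the induction for the domination by the factor
  \<open>m\<close>. Stage \<open>m\<close> respects the upper bounds \<open>\<xi> j\<close> with
  \<open>j < m\<close> only; index \<open>m\<close> joins at the next stage.\<close>

definition settled :: "nat \<Rightarrow> real \<Rightarrow> bool" where
  "settled m s \<longleftrightarrow>
     (ctl m has_real_derivative deriv (ctl m) s) (at s) \<and> isCont (deriv \<phi>) s \<and> deriv \<phi> s > 0 \<and>
     real m * deriv (ctl m) s \<le> exp (ctl m s) * deriv \<phi> s \<and> ctl m s \<ge> 1 \<and>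
     (\<forall>j\<le>m. a j s < ctl m s) \<and> (\<forall>j<m. ctl m s < \<xi> j m s) \<and>
     (\<forall>j<m. \<forall>k<m. (\<xi> j k has_real_derivative exp (\<xi> j (Suc k) s) * deriv \<phi> s) (at s))"

lemma eventually_settled: "\<forall>\<^sub>F s in at_top. settled m s"
proof -
  note c = above_inH[OF above_ctl[of m]] above_at_top[OF above_ctl[of m]]
  have "\<forall>\<^sub>F s in at_top. ctl m s \<ge> 1"
    using c(2) by (simp add: filterlim_at_top)
  \<comment> \<open>\<open>log_rate_less\<close> with factor 2 bounds the scaled derivative by
    \<open>exp (ctl m / 2)\<close>; the other half of the exponent absorbs the factor
    \<open>m\<close>.\<close>
  moreover have "\<forall>\<^sub>F s in at_top. real m * deriv (ctl m) s \<le> exp (ctl m s) * deriv \<phi> s"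
  proof -
    have "\<forall>\<^sub>F s in at_top. real m \<le> ctl m s"
      using c(2) by (simp add: filterlim_at_top)
    then show ?thesis
      using log_rate_less[OF c, of 2] exp_log_rate[OF c] deriv_scale_pos
    proof eventually_elim
      case (elim s)
      have "real m \<le> exp (ctl m s / 2)"
      proof -
        have "1 + ctl m s / 2 + (ctl m s / 2)\<^sup>2 / 2 \<le> exp (ctl m s / 2)"
          using elim by (intro exp_lower_Taylor_quadratic) auto
        moreover have "(ctl m s - 2)\<^sup>2 \<ge> 0"
          by simp
        ultimately show ?thesis
          using elim by (simp add: power2_eq_square field_simps)
      qed
      moreover have "exp (log_rate (ctl m) s) \<le> exp (ctl m s / 2)"
        using elim by simp
      ultimately have "real m * exp (log_rate (ctl m) s) \<le> exp (ctl m s / 2) * exp (ctl m s / 2)"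
        by (intro mult_mono) auto
      also have "\<dots> = exp (ctl m s)"
        by (simp flip: exp_add)
      finally have "real m * exp (log_rate (ctl m) s) * deriv \<phi> s \<le> exp (ctl m s) * deriv \<phi> s"
        using elim by (intro mult_right_mono) auto
      then show ?case
        using elim by (simp add: mult.assoc)
    qed
  qed
  moreover have "\<forall>\<^sub>F s in at_top. \<forall>j\<in>{..m}. a j s < ctl m s"
    using above_less[OF above_ctl inA_a] by (intro eventually_ball_finite) auto
  moreover have "\<forall>\<^sub>F s in at_top. \<forall>j\<in>{..<m}. ctl m s < \<xi> j m s"
  proof (intro eventually_ball_finite ballI)
    fix j assume "j \<in> {..<m}"
    then show "\<forall>\<^sub>F s in at_top. ctl m s < \<xi> j m s"
      using ctl_le_\<xi>[of j m] by (auto elim: eventually_mono)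
  qed simp
  moreover have "\<forall>\<^sub>F s in at_top. \<forall>j\<in>{..<m}. \<forall>k\<in>{..<m}.
      (\<xi> j k has_real_derivative exp (\<xi> j (Suc k) s) * deriv \<phi> s) (at s)"
    using has_deriv_\<xi> by (intro eventually_ball_finite ballI) auto
  moreover note inH_has_deriv[OF c(1)] inH_isCont[OF inH_deriv[OF inH_scale]] deriv_scale_pos
  ultimately show ?thesis
    by eventually_elim (simp add: settled_def)
qed

text \<open>A stage solves the system on the whole half-line from \<open>t\<close>, with components
  in \<open>H\<close>, although only an initial piece is kept. Asymptotic facts about
  \<open>H\<close> thus apply to it and yield a starting point for the next stage.\<close>

definition phase :: "nat \<Rightarrow> real \<Rightarrow> (nat \<Rightarrow> real \<Rightarrow> real) \<Rightarrow> bool" where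
  "phase m t X \<longleftrightarrow> (\<forall>s\<ge>t. settled m s) \<and> X m = ctl m \<and> (\<forall>k\<le>m. inH (X k)) \<and>
     (\<forall>k<m. \<forall>s\<ge>t. (X k has_real_derivative exp (X (Suc k) s) * deriv \<phi> s) (at s within {t..})) \<and>
     (\<forall>k\<le>m. \<forall>s\<ge>t. ctl m s \<le> X k s) \<and>
     (\<forall>k<m. \<forall>s\<ge>t. real m * X (Suc k) s \<le> X k s) \<and>
     (\<forall>k\<le>m. \<forall>s\<ge>t. \<forall>j<m. X k s < \<xi> j k s)"

text \<open>Each inequality holds for the top component by \<open>settled\<close> and descends from
  index \<open>Suc k\<close> to \<open>k\<close>: it orders the derivatives, and the initial values
  \<open>c\<close> order the functions at \<open>t\<close>.\<close>

lemma phase_start: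
  assumes settled: "\<And>s. s \<ge> t \<Longrightarrow> settled m s"
    and c: "c m = ctl m t"
    and less: "\<And>j k. j < m \<Longrightarrow> k < m \<Longrightarrow> c k < \<xi> j k t"
    and dom: "\<And>k. k < m \<Longrightarrow> real m * c (Suc k) \<le> c k"
  shows "\<exists>X. phase m t X \<and> (\<forall>k\<le>m. X k t = c k)"
proof -
  have deriv_ctl: "(ctl m has_real_derivative deriv (ctl m) s) (at s within {t..})"
    if "s \<ge> t" for s
    using settled[OF that] by (auto simp: settled_def intro: has_field_derivative_at_within)
  then have "continuous_on {t..} (ctl m)"
    by (intro DERIV_continuous_on) auto
  moreover have "continuous_on {t..} (deriv \<phi>)"
    using settled by (intro continuous_at_imp_continuous_on) (auto simp: settled_def)
  ultimately obtain X where Xm: "X m = ctl m" and Xt: "\<forall>k<m. X k t = c k"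
    and deriv_X: "\<And>k s. k < m \<Longrightarrow> s \<ge> t \<Longrightarrow>
      (X k has_real_derivative exp (X (Suc k) s) * deriv \<phi> s) (at s within {t..})"
    using exponential_flow_exists[of t "ctl m" "deriv \<phi>" m c] by blast
  have Xt': "X k t = c k" if "k \<le> m" for k
    using that Xt Xm c by (cases "k = m") auto
  have inH_X: "inH (X k)" if "k \<le> m" for k
    using that
  proof (induction k rule: inc_induct)
    case base
    show ?case by (simp add: Xm above_inH[OF above_ctl])
  next
    case (step k)
    have "\<forall>\<^sub>F s in at_top. s > t"
      by (rule eventually_gt_at_top)
    then have "\<forall>\<^sub>F s in at_top. (X k has_real_derivative exp (X (Suc k) s) * deriv \<phi> s) (at s)"
    proof eventually_elim
      case (elim s)
      then show ?case
        using has_real_derivative_within_atLeast[OF deriv_X[of k s]] step.hyps by simp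
    qed
    moreover have "inH (\<lambda>s. exp (X (Suc k) s) * deriv \<phi> s)"
      using step.IH by (intro inH_mult inH_exp inH_deriv inH_scale)
    ultimately show ?case
      by (rule inH_of_deriv[rotated])
  qed
  have lower: "\<forall>i\<in>{k..m}. \<forall>s\<ge>t. ctl m s \<le> X i s \<and> (i < m \<longrightarrow> real m * X (Suc i) s \<le> X i s)"
    if "k \<le> m" for k
    using that
  proof (induction k rule: inc_induct)
    case base
    show ?case by (simp add: Xm)
  next
    case (step k)
    have m: "real m \<ge> 1"
      using step.hyps by simp
    have IH: "ctl m s \<le> X i s" "i < m \<Longrightarrow> real m * X (Suc i) s \<le> X i s"
      if "Suc k \<le> i" "i \<le> m" "s \<ge> t" for i s
      using step.IH that by auto
    have ge1: "1 \<le> X i s" if "Suc k \<le> i" "i \<le> m" "s \<ge> t" for i s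
      using IH(1)[OF that] settled[OF that(3)] by (simp add: settled_def)
    \<comment> \<open>The derivative of \<open>X (Suc k)\<close>; the top component obeys no
      equation of the system, so there it is that of the control.\<close>
    define D' where "D' = (\<lambda>s. if Suc k = m then deriv (ctl m) s
      else exp (X (Suc (Suc k)) s) * deriv \<phi> s)"
    have D: "(X (Suc k) has_real_derivative D' s) (at s within {t..})" if "s \<ge> t" for s
      using deriv_ctl[OF that] deriv_X[of "Suc k" s] step.hyps that Xm by (auto simp: D'_def)
    have rate: "real m * D' s \<le> exp (X (Suc k) s) * deriv \<phi> s" if s: "s \<ge> t" for s
    proof (cases "Suc k = m")
      case True
      then show ?thesis
        using settled[OF s] Xm by (simp add: D'_def settled_def)
    next
      case False
      define v where "v = X (Suc (Suc k)) s"
      \<comment> \<open>From \<open>v \<ge> 1\<close> and \<open>ln m \<le> m - 1\<close> follows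
        \<open>ln m + v \<le> m * v \<le> X (Suc k) s\<close>; exponentiation gives the inequality
        between derivatives.\<close>
      have "(real m - 1) * 1 \<le> (real m - 1) * v"
        unfolding v_def using ge1 step.hyps False s m by (intro mult_left_mono) auto
      moreover have "real m * v \<le> X (Suc k) s"
        unfolding v_def using IH(2) step.hyps False s by simp
      moreover have "ln (real m) \<le> real m - 1"
        using m by (intro ln_le_minus_one) auto
      ultimately have "ln (real m) + v \<le> X (Suc k) s"
        by (simp add: algebra_simps)
      then have "exp (ln (real m) + v) \<le> exp (X (Suc k) s)"
        by simp
      then have "real m * exp v \<le> exp (X (Suc k) s)"
        using m by (simp add: exp_add)
      then have "real m * exp v * deriv \<phi> s \<le> exp (X (Suc k) s) * deriv \<phi> s"
        using settled[OF s] by (intro mult_right_mono) (auto simp: settled_def)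
      then show ?thesis
        using False by (simp add: D'_def v_def mult.assoc)
    qed
    have dom': "real m * X (Suc k) s \<le> X k s" if s: "s \<ge> t" for s
    proof -
      have "X k t - real m * X (Suc k) t \<le> X k s - real m * X (Suc k) s"
      proof (rule nondecreasing_from_initial[OF _ _ s])
        fix s assume s: "s \<ge> t"
        show "((\<lambda>s. X k s - real m * X (Suc k) s) has_real_derivative
            exp (X (Suc k) s) * deriv \<phi> s - real m * D' s) (at s within {t..})"
          using deriv_X[of k s] D[OF s] step.hyps s by (intro DERIV_diff DERIV_cmult) auto
        show "exp (X (Suc k) s) * deriv \<phi> s - real m * D' s \<ge> 0"
          using rate[OF s] by simp
      qed
      moreover have "real m * X (Suc k) t \<le> X k t"
        using dom[of k] Xt' step.hyps by simp
      ultimately show ?thesis by linarith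
    qed
    have "ctl m s \<le> X k s" if s: "s \<ge> t" for s
    proof -
      have "1 * X (Suc k) s \<le> real m * X (Suc k) s"
        using m ge1[of "Suc k" s] step.hyps s by (intro mult_right_mono) auto
      then show ?thesis
        using dom'[OF s] IH(1)[of "Suc k" s] step.hyps s by simp
    qed
    then have "ctl m s \<le> X i s \<and> (i < m \<longrightarrow> real m * X (Suc i) s \<le> X i s)"
      if "k \<le> i" "i \<le> m" "s \<ge> t" for i s
      using dom' IH[of i s] that by (cases "i = k") auto
    then show ?case by simp
  qed
  have upper: "\<forall>s\<ge>t. \<forall>j<m. X k s < \<xi> j k s" if "k \<le> m" for k
    using that
  proof (induction k rule: inc_induct)
    case base
    show ?case
      using settled by (auto simp: Xm settled_def)
  next
    case (step k)
    show ?case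
    proof (intro allI impI)
      fix s j assume s: "t \<le> s" and j: "j < m"
      \<comment> \<open>The \<open>\<xi> j\<close> solve the same system, so a larger next component
        makes the difference nondecreasing.\<close>
      have "\<xi> j k t - X k t \<le> \<xi> j k s - X k s"
      proof (rule nondecreasing_from_initial[OF _ _ s])
        fix s assume s: "s \<ge> t"
        show "((\<lambda>s. \<xi> j k s - X k s) has_real_derivative
            exp (\<xi> j (Suc k) s) * deriv \<phi> s - exp (X (Suc k) s) * deriv \<phi> s) (at s within {t..})"
          using deriv_X[of k s] settled[OF s] step.hyps s j unfolding settled_def
          by (intro DERIV_diff) (auto intro: has_field_derivative_at_within)
        have "X (Suc k) s < \<xi> j (Suc k) s"
          using step.IH s j by blast
        then show "exp (\<xi> j (Suc k) s) * deriv \<phi> s - exp (X (Suc k) s) * deriv \<phi> s \<ge> 0"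
          using settled[OF s] by (simp add: settled_def)
      qed
      moreover have "X k t < \<xi> j k t"
        using less[OF j] Xt' step.hyps by simp
      ultimately show "X k s < \<xi> j k s" by linarith
    qed
  qed
  have "phase m t X"
    unfolding phase_def using settled Xm inH_X deriv_X lower[of 0] upper by auto
  then show ?thesis
    using Xt' by blast
qed

lemma phase_at_top:
  assumes "phase m t X" and "k \<le> m"
  shows "filterlim (X k) at_top at_top"
proof (rule filterlim_at_top_mono[OF above_at_top[OF above_ctl[of m]]])
  have "\<forall>\<^sub>F s in at_top. s \<ge> t"
    by (rule eventually_ge_at_top)
  then show "\<forall>\<^sub>F s in at_top. ctl m s \<le> X k s"
    by eventually_elim (use assms in \<open>simp add: phase_def\<close>)
qed

lemma phase_has_deriv:
  assumes "phase m t X" and "k < m"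
  shows "\<forall>\<^sub>F s in at_top. (X k has_real_derivative exp (X (Suc k) s) * deriv \<phi> s) (at s)"
proof -
  have "\<forall>\<^sub>F s in at_top. s > t"
    by (rule eventually_gt_at_top)
  then show ?thesis
  proof eventually_elim
    case (elim s)
    then show ?case
      using assms by (intro has_real_derivative_within_atLeast[of _ _ _ t]) (auto simp: phase_def)
  qed
qed

text \<open>The system says \<open>log_rate (X k) = X (Suc k)\<close>, and \<open>X k\<close> lies
  in \<open>H\<close>, so \<open>log_rate_less\<close> applies with every factor, in particular with
  that of the next stage.\<close>

lemma phase_eventually_dominates:
  assumes "phase m t X" and "k < m"
  shows "\<forall>\<^sub>F s in at_top. real p * X (Suc k) s < X k s"
proof -
  have "inH (X k)"
    using assms by (simp add: phase_def)
  from log_rate_less[OF this phase_at_top[OF assms(1)], of p] assms(2)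
  have "\<forall>\<^sub>F s in at_top. real p * log_rate (X k) s < X k s"
    by simp
  then show ?thesis
    using phase_has_deriv[OF assms] deriv_scale_pos
  proof eventually_elim
    case (elim s)
    then have "deriv (X k) s = exp (X (Suc k) s) * deriv \<phi> s"
      by (simp add: DERIV_imp_deriv)
    then have "log_rate (X k) s = X (Suc k) s"
      using elim by (simp add: log_rate_def)
    then show ?case
      using elim by simp
  qed
qed

text \<open>The margin \<open>1\<close> in \<open>X (Suc k) \<le> \<xi> m (Suc k) - 1\<close> gives a factor \<open>exp (- 1)\<close> after
  integration, which recovers the margin since \<open>\<xi> m k\<close> tends to infinity.\<close>

lemma phase_eventually_less_\<xi>:
  assumes phase: "phase m t X" and "k \<le> m"
  shows "\<forall>\<^sub>F s in at_top. X k s \<le> \<xi> m k s - 1"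
  using assms(2)
proof (induction k rule: inc_induct)
  case base
  show ?case
    using ctl_le_\<xi>[of m m] phase by (simp add: phase_def)
next
  case (step k)
  have "\<forall>\<^sub>F s in at_top. ((\<lambda>s. exp (- 1) * \<xi> m k s) has_real_derivative
      exp (- 1) * (exp (\<xi> m (Suc k) s) * deriv \<phi> s)) (at s)"
    using has_deriv_\<xi>[of m k] by eventually_elim (rule DERIV_cmult)
  moreover have "\<forall>\<^sub>F s in at_top. exp (X (Suc k) s) * deriv \<phi> s \<le>
      exp (- 1) * (exp (\<xi> m (Suc k) s) * deriv \<phi> s)"
    using step.IH deriv_scale_pos
  proof eventually_elim
    case (elim s)
    then have "exp (X (Suc k) s) \<le> exp (- 1 + \<xi> m (Suc k) s)"
      by simp
    then have "exp (X (Suc k) s) * deriv \<phi> s \<le> exp (- 1 + \<xi> m (Suc k) s) * deriv \<phi> s"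
      using elim by (intro mult_right_mono) auto
    then show ?case
      by (simp only: exp_add mult.assoc)
  qed
  ultimately obtain C where C: "\<forall>\<^sub>F s in at_top. X k s \<le> exp (- 1) * \<xi> m k s + C"
    using bounded_growth_of_deriv_le[OF phase_has_deriv[OF phase step.hyps(2)]] by meson
  \<comment> \<open>This threshold turns \<open>exp (- 1) * \<xi> m k s + C\<close> into at most
    \<open>\<xi> m k s - 1\<close>.\<close>
  have "\<forall>\<^sub>F s in at_top. (C + 1) / (1 - exp (- 1)) \<le> \<xi> m k s"
    using above_at_top[OF above_\<xi>] by (simp add: filterlim_at_top)
  with C show ?case
  proof eventually_elim
    case (elim s)
    have "1 - exp (- 1) > (0::real)"
      by simp
    then have "C + 1 \<le> \<xi> m k s * (1 - exp (- 1))"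
      using elim by (simp add: pos_divide_le_eq)
    then show ?case
      using elim by (simp add: algebra_simps)
  qed
qed

text \<open>A late enough \<open>t'\<close> satisfies all entry conditions of stage
  \<open>Suc m\<close>. The old components keep their values at \<open>t'\<close>, which makes the
  glued function continuous; the new one starts at the control. The distance 1 makes the starting
  points unbounded.\<close>

lemma phase_step:
  assumes phase: "phase m t X"
  shows "\<exists>t' X'. phase (Suc m) t' X' \<and> t + 1 \<le> t' \<and> (\<forall>k\<le>m. X' k t' = X k t')"
proof -
  have "\<forall>\<^sub>F s in at_top. \<forall>k\<in>{..m}. X k s < \<xi> m k s"
  proof (intro eventually_ball_finite ballI)
    fix k assume "k \<in> {..m}"
    then have "\<forall>\<^sub>F s in at_top. X k s \<le> \<xi> m k s - 1"
      by (intro phase_eventually_less_\<xi>[OF phase]) simp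
    then show "\<forall>\<^sub>F s in at_top. X k s < \<xi> m k s"
      by eventually_elim simp
  qed simp
  moreover have "\<forall>\<^sub>F s in at_top. \<forall>k\<in>{..<m}. real (Suc m) * X (Suc k) s < X k s"
    by (intro eventually_ball_finite ballI phase_eventually_dominates[OF phase]) auto
  moreover have "\<forall>\<^sub>F s in at_top. s \<ge> t + 1"
    by (rule eventually_ge_at_top)
  moreover note ctl_Suc_less[of m] eventually_settled[of "Suc m"]
  ultimately have "\<forall>\<^sub>F s in at_top. (\<forall>k\<in>{..m}. X k s < \<xi> m k s) \<and>
      (\<forall>k\<in>{..<m}. real (Suc m) * X (Suc k) s < X k s) \<and> s \<ge> t + 1 \<and>
      real (Suc m) * ctl (Suc m) s < ctl m s \<and> settled (Suc m) s"
    by eventually_elim blast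
  then obtain t' where t': "\<And>s. s \<ge> t' \<Longrightarrow> (\<forall>k\<in>{..m}. X k s < \<xi> m k s) \<and>
      (\<forall>k\<in>{..<m}. real (Suc m) * X (Suc k) s < X k s) \<and> s \<ge> t + 1 \<and>
      real (Suc m) * ctl (Suc m) s < ctl m s \<and> settled (Suc m) s"
    unfolding eventually_at_top_linorder by blast
  define c where "c = (\<lambda>k. if k \<le> m then X k t' else ctl (Suc m) t')"
  have t: "t' \<ge> t"
    using t'[of t'] by simp
  have Xm: "X m = ctl m"
    using phase by (simp add: phase_def)
  have "\<exists>X'. phase (Suc m) t' X' \<and> (\<forall>k\<le>Suc m. X' k t' = c k)"
  proof (rule phase_start)
    show "settled (Suc m) s" if "s \<ge> t'" for s
      using t'[OF that] by blast
    show "c (Suc m) = ctl (Suc m) t'"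
      by (simp add: c_def)
    show "c k < \<xi> j k t'" if "j < Suc m" "k < Suc m" for j k
    \<comment> \<open>Index \<open>m\<close> is the upper bound that joins now; the others are
      inherited from stage \<open>m\<close>.\<close>
    proof (cases "j = m")
      case True
      then show ?thesis
        using t'[of t'] that by (simp add: c_def)
    next
      case False
      then show ?thesis
        using phase t that by (simp add: c_def phase_def)
    qed
    show "real (Suc m) * c (Suc k) \<le> c k" if "k < Suc m" for k
    proof (cases "k = m")
      case True
      then show ?thesis
        using t'[of t'] by (simp add: c_def Xm)
    next
      case False
      then have "real (Suc m) * X (Suc k) t' < X k t'"
        using t'[of t'] that by simp
      then show ?thesis
        using False that by (simp add: c_def)
    qed
  qed
  then obtain X' where "phase (Suc m) t' X'" "\<forall>k\<le>Suc m. X' k t' = c k"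
    by blast
  then show ?thesis
    using t'[of t'] by (intro exI[of _ t'] exI[of _ X']) (auto simp: c_def)
qed

lemma phases_exist:
  "\<exists>t X. (\<forall>m. phase m (t m) (X m)) \<and> (\<forall>m. t m + 1 \<le> t (Suc m)) \<and>
     (\<forall>m k. k \<le> m \<longrightarrow> X (Suc m) k (t (Suc m)) = X m k (t (Suc m)))"
proof -
  let ?P = "\<lambda>m p. phase m (fst p) (snd p)"
  let ?Q = "\<lambda>m p p'. fst p + 1 \<le> fst p' \<and> (\<forall>k\<le>m. snd p' k (fst p') = snd p k (fst p'))"
  have "\<exists>p. ?P 0 p"
  proof -
    obtain t where t: "\<And>s. s \<ge> t \<Longrightarrow> settled 0 s"
      using eventually_settled[of 0] unfolding eventually_at_top_linorder by blast
    have "\<exists>X. phase 0 t X \<and> (\<forall>k\<le>0. X k t = ctl 0 t)"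
      by (rule phase_start[OF t]) auto
    then show ?thesis by auto
  qed
  moreover have "\<exists>p'. ?P (Suc m) p' \<and> ?Q m p p'" if "?P m p" for m p
    using phase_step[OF that] by auto
  ultimately obtain p where "\<forall>m. ?P m (p m)" "\<forall>m. ?Q m (p m) (p (Suc m))"
    using dependent_nat_choice[of ?P ?Q] by blast
  then show ?thesis
    by (intro exI[of _ "\<lambda>m. fst (p m)"] exI[of _ "\<lambda>m. snd (p m)"]) auto
qed

end

section \<open>Gluing the stages to one solution\<close>

context countable_wide_gap_field
begin

text \<open>The solution follows stage \<open>m\<close> on \<open>[t m, t (Suc m))\<close>. Each
  single bound or factor is in force from some stage on, hence holds eventually.\<close>

lemma solution_exists:
  "\<exists>x. (\<forall>k. \<forall>\<^sub>F s in at_top. (x k has_real_derivative exp (x (Suc k) s) * deriv \<phi> s) (at s)) \<and>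
     (\<forall>j k. \<forall>\<^sub>F s in at_top. a j s < x k s) \<and>
     (\<forall>j k. \<forall>\<^sub>F s in at_top. x k s < \<xi> j k s) \<and>
     (\<forall>k p. \<forall>\<^sub>F s in at_top. real p * x (Suc k) s \<le> x k s)"
proof -
  obtain t X where phase: "\<And>m. phase m (t m) (X m)" and step: "\<And>m. t m + 1 \<le> t (Suc m)"
    and agree: "\<And>m k. k \<le> m \<Longrightarrow> X (Suc m) k (t (Suc m)) = X m k (t (Suc m))"
    using phases_exist by blast
  have "strict_mono t"
    by (rule strict_monoI_Suc) (use step less_le_trans in \<open>smt (verit)\<close>)
  then have t_le: "t m \<le> t n \<longleftrightarrow> m \<le> n" and t_less: "t m < t n \<longleftrightarrow> m < n" for m n
    by (simp_all add: strict_mono_less_eq strict_mono_less)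
  have t_ge: "t 0 + real m \<le> t m" for m
  proof (induction m)
    case (Suc m)
    then show ?case using step[of m] by simp
  qed simp
  define N where "N = (\<lambda>s. LEAST m. s < t (Suc m))"
  have unbounded: "\<exists>m. s < t (Suc m)" for s
  proof -
    obtain m where "s - t 0 < real m"
      using reals_Archimedean2 by blast
    then show ?thesis
      using t_ge[of "Suc m"] by (intro exI[of _ m]) simp
  qed
  have N_eq: "N s = m" if "t m \<le> s" "s < t (Suc m)" for s m
    unfolding N_def
  proof (rule Least_equality)
    show "m \<le> n" if "s < t (Suc n)" for n
    proof -
      have "t m < t (Suc n)"
        using \<open>t m \<le> s\<close> that by simp
      then show ?thesis by (simp add: t_less)
    qed
  qed (rule that(2))
  have N_bounds: "t (N s) \<le> s" "s < t (Suc (N s))" if "t 0 \<le> s" for s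
  proof -
    show less: "s < t (Suc (N s))"
      unfolding N_def using unbounded by (rule LeastI_ex)
    show "t (N s) \<le> s"
    proof (cases "N s")
      case (Suc n)
      then have "\<not> s < t (Suc n)"
        using not_less_Least[of n "\<lambda>m. s < t (Suc m)"] by (simp add: N_def)
      then show ?thesis using Suc by simp
    qed (use that in simp)
  qed
  have N_ge: "M \<le> N s" if "t M \<le> s" for s M
  proof -
    have "t M < t (Suc (N s))"
      using N_bounds(2)[of s] that t_le[of 0 M] by simp
    then show ?thesis by (simp add: t_less)
  qed
  have eventually_N: "\<forall>\<^sub>F s in at_top. M \<le> N s \<and> t (N s) \<le> s" for M
    unfolding eventually_at_top_linorder
    using N_ge N_bounds(1) t_le[of 0 M] by (intro exI[of _ "t M"]) (auto intro: order_trans)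
  define x where "x = (\<lambda>k s. X (N s) k s)"
  \<comment> \<open>Two stages of reserve: at a breakpoint the preceding stage must already contain
    the components \<open>k\<close> and \<open>Suc k\<close>.\<close>
  have "\<forall>\<^sub>F s in at_top. (x k has_real_derivative exp (x (Suc k) s) * deriv \<phi> s) (at s)" for k
    using eventually_N[of "Suc (Suc k)"]
  proof eventually_elim
    case (elim s)
    define m where "m = N s"
    define D where "D = exp (x (Suc k) s) * deriv \<phi> s"
    have "t 0 \<le> t m"
      by (simp add: t_le)
    then have m: "Suc (Suc k) \<le> m" "t m \<le> s" "s < t (Suc m)"
      using elim N_bounds(2)[of s] by (auto simp: m_def)
    have right_deriv: "(X m k has_real_derivative D) (at s within {t m..})"
      using phase[of m] m unfolding phase_def D_def x_def m_def[symmetric] by simp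
    have right: "\<forall>\<^sub>F y in at_right s. X m k y = x k y"
      unfolding eventually_at_right_field
    proof (intro exI[of _ "t (Suc m)"] conjI allI impI)
      fix y assume "s < y" "y < t (Suc m)"
      then have "N y = m"
        using m by (intro N_eq) auto
      then show "X m k y = x k y"
        by (simp add: x_def)
    qed (rule m(3))
    have "(x k has_real_derivative D) (at s)"
    proof (cases "t m < s")
      case True
      have left: "\<forall>\<^sub>F y in at_left s. X m k y = x k y"
        unfolding eventually_at_left_field
      proof (intro exI[of _ "t m"] conjI allI impI)
        fix y assume "t m < y" "y < s"
        then have "N y = m"
          using m by (intro N_eq) auto
        then show "X m k y = x k y"
          by (simp add: x_def)
      qed (rule True)
      have deriv: "(X m k has_real_derivative D) (at s)"
        using has_real_derivative_within_atLeast[OF right_deriv True] .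
      show ?thesis
        by (rule has_real_derivative_glue[OF deriv has_field_derivative_at_within[OF deriv]
            left right]) (simp_all add: x_def m_def)
    next
      case False
      \<comment> \<open>At a breakpoint the left derivative comes from the preceding stage. It is
        the same number, since the values of component \<open>Suc k\<close> agree there.\<close>
      then have s: "s = t m"
        using m by simp
      obtain n where n: "m = Suc n"
        using m by (cases m) auto
      have left: "\<forall>\<^sub>F y in at_left s. X n k y = x k y"
        unfolding eventually_at_left_field
      proof (intro exI[of _ "t n"] conjI allI impI)
        fix y assume "t n < y" "y < s"
        then have "N y = n"
          using s n by (intro N_eq) auto
        then show "X n k y = x k y"
          by (simp add: x_def)
      qed (use s n t_less in simp)
      have X_eq: "X n i s = X m i s" if "i \<le> n" for i
        using agree[OF that] s n by simp
      have "(X n k has_real_derivative exp (X n (Suc k) s) * deriv \<phi> s) (at s within {t n..})"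
        using phase[of n] m n s t_le[of n m] unfolding phase_def by simp
      then have "(X n k has_real_derivative exp (X n (Suc k) s) * deriv \<phi> s) (at s)"
        by (rule has_real_derivative_within_atLeast) (use s n t_less in simp)
      then have deriv: "(X n k has_real_derivative D) (at s)"
        using X_eq[of "Suc k"] m n by (simp add: D_def x_def m_def[symmetric])
      have "(X m k has_real_derivative D) (at s within {s..})"
        using right_deriv s by simp
      then show ?thesis
        using X_eq[of k] m n
        by (intro has_real_derivative_glue[OF deriv _ left right]) (simp_all add: x_def m_def[symmetric])
    qed
    then show ?case by (simp add: D_def)
  qed
  moreover have "\<forall>\<^sub>F s in at_top. a j s < x k s" for j k
    using eventually_N[of "max j k"]
  proof eventually_elim
    case (elim s)
    then have "a j s < ctl (N s) s" "ctl (N s) s \<le> X (N s) k s"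
      using phase[of "N s"] by (auto simp: phase_def settled_def)
    then show ?case by (simp add: x_def)
  qed
  moreover have "\<forall>\<^sub>F s in at_top. x k s < \<xi> j k s" for j k
    using eventually_N[of "max (Suc j) k"]
  proof eventually_elim
    case (elim s)
    then show ?case
      using phase[of "N s"] by (simp add: phase_def x_def)
  qed
  moreover have "\<forall>\<^sub>F s in at_top. real p * x (Suc k) s \<le> x k s" for k p
    using eventually_N[of "max p (Suc k)"]
  proof eventually_elim
    case (elim s)
    then have "ctl (N s) s \<le> X (N s) (Suc k) s" "ctl (N s) s \<ge> 1"
      and *: "real (N s) * X (N s) (Suc k) s \<le> X (N s) k s"
      using phase[of "N s"] by (auto simp: phase_def settled_def)
    then have "real p * X (N s) (Suc k) s \<le> real (N s) * X (N s) (Suc k) s"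
      using elim by (intro mult_right_mono) auto
    with * show ?case
      by (simp add: x_def)
  qed
  ultimately show ?thesis by blast
qed

end

section \<open>Adjoining dominant generators\<close>

definition subring_of_germs :: "germ set \<Rightarrow> bool" where
  "subring_of_germs R \<longleftrightarrow> 0 \<in> R \<and> 1 \<in> R \<and> (\<forall>f\<in>R. \<forall>g\<in>R. f + g \<in> R \<and> f * g \<in> R) \<and> (\<forall>f\<in>R. - f \<in> R)"

lemma subring_of_germsD:
  assumes "subring_of_germs R"
  shows "0 \<in> R" "1 \<in> R" "f \<in> R \<Longrightarrow> g \<in> R \<Longrightarrow> f + g \<in> R" "f \<in> R \<Longrightarrow> g \<in> R \<Longrightarrow> f * g \<in> R"
    "f \<in> R \<Longrightarrow> - f \<in> R"
  using assms by (auto simp: subring_of_germs_def)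

lemma subring_of_germs_diff: "subring_of_germs R \<Longrightarrow> f \<in> R \<Longrightarrow> g \<in> R \<Longrightarrow> f - g \<in> R"
  using subring_of_germsD(3)[of R f "- g"] subring_of_germsD(5)[of R g] by simp

lemma subring_of_germs_sum:
  assumes "subring_of_germs R" and "\<And>i. i \<in> I \<Longrightarrow> f i \<in> R"
  shows "sum f I \<in> R"
  using assms(2) by (induction I rule: infinite_finite_induct) (auto intro: subring_of_germsD[OF assms(1)])

definition adjoin :: "germ set \<Rightarrow> germ \<Rightarrow> germ set" where
  "adjoin R z = {poly p z | p. \<forall>i. coeff p i \<in> R}"

lemma subring_adjoin:
  assumes R: "subring_of_germs R"
  shows "subring_of_germs (adjoin R z)"
  unfolding subring_of_germs_def
proof (intro conjI ballI)
  note RD = subring_of_germsD[OF R]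
  show "0 \<in> adjoin R z"
    unfolding adjoin_def using RD by (auto intro!: exI[of _ 0])
  show "1 \<in> adjoin R z"
    unfolding adjoin_def using RD by (auto intro!: exI[of _ 1] simp: coeff_1)
  fix f assume "f \<in> adjoin R z"
  then obtain p where p: "f = poly p z" "\<And>i. coeff p i \<in> R"
    by (auto simp: adjoin_def)
  show "- f \<in> adjoin R z"
    unfolding adjoin_def using RD p by (auto intro!: exI[of _ "- p"])
  fix g assume "g \<in> adjoin R z"
  then obtain q where q: "g = poly q z" "\<And>i. coeff q i \<in> R"
    by (auto simp: adjoin_def)
  show "f + g \<in> adjoin R z"
    unfolding adjoin_def using RD p q by (auto intro!: exI[of _ "p + q"])
  have "coeff (p * q) i \<in> R" for i
    using RD p q by (auto simp: coeff_mult intro!: subring_of_germs_sum[OF R])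
  then show "f * g \<in> adjoin R z"
    unfolding adjoin_def using p q by (auto intro!: exI[of _ "p * q"])
qed

lemma subset_adjoin:
  assumes "subring_of_germs R"
  shows "R \<subseteq> adjoin R z"
proof
  fix c assume "c \<in> R"
  then have "\<forall>i. coeff [:c:] i \<in> R"
    using subring_of_germsD(1)[OF assms] by (auto simp: coeff_pCons split: nat.split)
  then show "c \<in> adjoin R z"
    unfolding adjoin_def by (auto intro!: exI[of _ "[:c:]"])
qed

lemma generator_in_adjoin:
  assumes "subring_of_germs R"
  shows "z \<in> adjoin R z"
proof -
  have "\<forall>i. coeff [:0, 1:] i \<in> R"
    using subring_of_germsD(1,2)[OF assms] by (auto simp: coeff_pCons split: nat.split)
  then show ?thesis
    unfolding adjoin_def by (auto intro!: exI[of _ "[:0, 1:]"])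
qed

lemma adjoin_mono: "R \<subseteq> S \<Longrightarrow> adjoin R z \<subseteq> adjoin S z"
  unfolding adjoin_def by blast

section \<open>Separation by growth and dominant monomials\<close>

definition eventually_small :: "(real \<Rightarrow> real) \<Rightarrow> (real \<Rightarrow> real) \<Rightarrow> bool" where
  "eventually_small w h \<longleftrightarrow> (\<forall>p. \<forall>\<^sub>F t in at_top. \<bar>h t\<bar> ^ p < w t)"

definition eventually_large :: "(real \<Rightarrow> real) \<Rightarrow> (real \<Rightarrow> real) \<Rightarrow> bool" where
  "eventually_large w h \<longleftrightarrow> (\<forall>p. \<forall>\<^sub>F t in at_top. w t ^ p < \<bar>h t\<bar>)"

definition separated :: "(real \<Rightarrow> real) \<Rightarrow> (real \<Rightarrow> real) \<Rightarrow> bool" where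
  "separated w h \<longleftrightarrow> eventually_small w h \<or> eventually_large w h"

text \<open>The dichotomy decides which of two monomials in \<open>w\<close> over \<open>R\<close>
  dominates: no ratio of coefficients is comparable to a positive power of \<open>w\<close>.\<close>

definition separates_ratios :: "germ set \<Rightarrow> germ \<Rightarrow> bool" where
  "separates_ratios R w \<longleftrightarrow>
     (\<forall>c\<in>R - {0}. \<forall>d\<in>R - {0}. separated (rep_germ w) (\<lambda>t. rep_germ c t / rep_germ d t))"

text \<open>A nonzero germ may vanish at arbitrarily large arguments; excluding this makes it
  invertible in the ring of all germs.\<close>

definition eventually_nonzero :: "germ set \<Rightarrow> bool" where
  "eventually_nonzero R \<longleftrightarrow> (\<forall>c\<in>R - {0}. \<forall>\<^sub>F t in at_top. rep_germ c t \<noteq> 0)"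

lemma rep_germ_of: "\<forall>\<^sub>F t in at_top. rep_germ (germ_of f) t = f t"
  using germ_of_eq_iff[of "rep_germ (germ_of f)" f] by simp

lemma rep_germ_add: "\<forall>\<^sub>F t in at_top. rep_germ (f + g) t = rep_germ f t + rep_germ g t"
  using plus_germ.abs_eq[of "rep_germ f" "rep_germ g"] rep_germ_of by simp

lemma rep_germ_mult: "\<forall>\<^sub>F t in at_top. rep_germ (f * g) t = rep_germ f t * rep_germ g t"
  using times_germ.abs_eq[of "rep_germ f" "rep_germ g"] rep_germ_of by simp

text \<open>The exponent 2 gives a bound by the inverse square root of \<open>w\<close>.\<close>

lemma small_ratio_tendsto_0:
  assumes "eventually_small w h" and "filterlim w at_top at_top"
  shows "((\<lambda>t. h t / w t) \<longlongrightarrow> 0) at_top"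
proof -
  have "((\<lambda>t. inverse (w t)) \<longlongrightarrow> 0) at_top"
    using assms(2) by (rule tendsto_inverse_0_at_top)
  then have "((\<lambda>t. sqrt (inverse (w t))) \<longlongrightarrow> sqrt 0) at_top"
    by (rule tendsto_real_sqrt)
  then have lim: "((\<lambda>t. sqrt (inverse (w t))) \<longlongrightarrow> 0) at_top"
    by simp
  have "\<forall>\<^sub>F t in at_top. w t > 0"
    using assms(2) by (simp add: filterlim_at_top_dense)
  moreover have "\<forall>\<^sub>F t in at_top. \<bar>h t\<bar> ^ 2 < w t"
    using assms(1) unfolding eventually_small_def by blast
  ultimately have "\<forall>\<^sub>F t in at_top. norm (h t / w t) \<le> sqrt (inverse (w t))"
  proof eventually_elim
    case (elim t)
    have "(\<bar>h t\<bar> / w t)\<^sup>2 = \<bar>h t\<bar>\<^sup>2 / w t / w t"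
      by (simp add: power2_eq_square)
    also have "\<dots> \<le> 1 / w t"
      using elim by (intro divide_right_mono) (auto simp: divide_le_eq)
    finally have "(\<bar>h t\<bar> / w t)\<^sup>2 \<le> inverse (w t)"
      by (simp add: inverse_eq_divide)
    then have "\<bar>h t\<bar> / w t \<le> sqrt (inverse (w t))"
      by (rule real_le_rsqrt)
    then show ?case
      using elim by (simp add: abs_divide)
  qed
  then show ?thesis
    by (rule Lim_null_comparison[OF _ lim])
qed

lemma power_ratio_large_tendsto_0:
  assumes "eventually_large w h" and "filterlim w at_top at_top"
  shows "((\<lambda>t. w t ^ i / h t) \<longlongrightarrow> 0) at_top"
proof -
  have lim: "((\<lambda>t. inverse (w t)) \<longlongrightarrow> 0) at_top"
    using assms(2) by (rule tendsto_inverse_0_at_top)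
  have "\<forall>\<^sub>F t in at_top. w t > 0"
    using assms(2) by (simp add: filterlim_at_top_dense)
  moreover have "\<forall>\<^sub>F t in at_top. w t ^ Suc i < \<bar>h t\<bar>"
    using assms(1) unfolding eventually_large_def by blast
  ultimately have "\<forall>\<^sub>F t in at_top. norm (w t ^ i / h t) \<le> inverse (w t)"
  proof eventually_elim
    case (elim t)
    have "\<bar>h t\<bar> > 0"
      using elim by (meson less_trans zero_less_power)
    then show ?case
      using elim by (simp add: abs_divide field_simps)
  qed
  then show ?thesis
    by (rule Lim_null_comparison[OF _ lim])
qed

text \<open>Induction by the Horner scheme \<open>c + z * Q\<close> with \<open>Q\<close> asymptotic
  to \<open>d * z ^ i\<close>. If \<open>c / d\<close> is small, the leading term is
  \<open>d * z ^ Suc i\<close>; if it is large, \<open>c\<close> beats all powers of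
  \<open>z\<close> and leads alone.\<close>

lemma leading_term:
  assumes R: "subring_of_germs R" and nz: "eventually_nonzero R" and sep: "separates_ratios R z"
    and z: "filterlim (rep_germ z) at_top at_top"
    and "\<And>i. coeff p i \<in> R"
  shows "poly p z = 0 \<or> (\<exists>d\<in>R - {0}. \<exists>i.
    ((\<lambda>t. rep_germ (poly p z) t / (rep_germ d t * rep_germ z t ^ i)) \<longlongrightarrow> 1) at_top)"
  using assms(5)
proof (induction p)
  case 0
  show ?case by simp
next
  case (pCons c p)
  have c: "c \<in> R" and p: "\<And>i. coeff p i \<in> R"
    using pCons.prems[of 0] pCons.prems[of "Suc i" for i] by auto
  define Q where "Q = poly p z"
  have eq: "poly (pCons c p) z = c + z * Q"
    by (simp add: Q_def)
  have zpos: "\<forall>\<^sub>F t in at_top. rep_germ z t > 0"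
    using z by (simp add: filterlim_at_top_dense)
  have rep_eq: "\<forall>\<^sub>F t in at_top. rep_germ (c + z * Q) t = rep_germ c t + rep_germ z t * rep_germ Q t"
    using rep_germ_add[of c "z * Q"] rep_germ_mult[of z Q] by eventually_elim simp
  consider "Q = 0" "c = 0" | "Q = 0" "c \<noteq> 0" | "Q \<noteq> 0"
    by blast
  then show ?case
  proof cases
    case 1
    then show ?thesis unfolding eq by simp
  next
    case 2
    have "\<forall>\<^sub>F t in at_top. rep_germ c t \<noteq> 0"
      using nz c 2 by (simp add: eventually_nonzero_def)
    then have "\<forall>\<^sub>F t in at_top. 1 = rep_germ c t / (rep_germ c t * rep_germ z t ^ 0)"
      by eventually_elim simp
    then have "((\<lambda>t. rep_germ c t / (rep_germ c t * rep_germ z t ^ 0)) \<longlongrightarrow> 1) at_top"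
      by (rule Lim_transform_eventually[OF tendsto_const])
    moreover have "poly (pCons c p) z = c"
      unfolding eq using 2 by simp
    ultimately show ?thesis
      using c 2 by (metis DiffI singletonD)
  next
    case 3
    then obtain d i where d: "d \<in> R" "d \<noteq> 0"
      and lim: "((\<lambda>t. rep_germ Q t / (rep_germ d t * rep_germ z t ^ i)) \<longlongrightarrow> 1) at_top"
      using pCons.IH[OF p] unfolding Q_def[symmetric] by blast
    have dnz: "\<forall>\<^sub>F t in at_top. rep_germ d t \<noteq> 0"
      using nz d by (simp add: eventually_nonzero_def)
    \<comment> \<open>The hypothesis says that \<open>c\<close> is negligible against
      \<open>d * z ^ Suc i\<close>; it covers both \<open>c = 0\<close> and small ratios.\<close>
    have d_leads: ?thesis
      if *: "((\<lambda>t. rep_germ c t / rep_germ d t / rep_germ z t * (1 / rep_germ z t ^ i)) \<longlongrightarrow> 0) at_top"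
    proof -
      have "((\<lambda>t. rep_germ c t / rep_germ d t / rep_germ z t * (1 / rep_germ z t ^ i) +
          rep_germ Q t / (rep_germ d t * rep_germ z t ^ i)) \<longlongrightarrow> 0 + 1) at_top"
        by (intro tendsto_add * lim)
      moreover have "\<forall>\<^sub>F t in at_top. rep_germ c t / rep_germ d t / rep_germ z t * (1 / rep_germ z t ^ i) +
          rep_germ Q t / (rep_germ d t * rep_germ z t ^ i) =
          rep_germ (c + z * Q) t / (rep_germ d t * rep_germ z t ^ Suc i)"
        using rep_eq dnz zpos by eventually_elim (simp add: field_simps)
      ultimately have "((\<lambda>t. rep_germ (c + z * Q) t / (rep_germ d t * rep_germ z t ^ Suc i)) \<longlongrightarrow> 0 + 1) at_top"
        by (rule Lim_transform_eventually)
      then show ?thesis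
        using d unfolding eq add_0 by blast
    qed
    show ?thesis
    proof (cases "c = 0")
      case True
      have "((\<lambda>t. 0) \<longlongrightarrow> (0::real)) (at_top :: real filter)"
        by simp
      moreover have "\<forall>\<^sub>F t in at_top. 0 = rep_germ c t / rep_germ d t / rep_germ z t * (1 / rep_germ z t ^ i)"
        using rep_germ_of[of "\<lambda>_. 0"] unfolding True zero_germ_def by eventually_elim simp
      ultimately show ?thesis
        by (intro d_leads) (rule Lim_transform_eventually)
    next
      case False
      have "separated (rep_germ z) (\<lambda>t. rep_germ c t / rep_germ d t)"
        using sep c False d by (simp add: separates_ratios_def)
      then consider (small) "eventually_small (rep_germ z) (\<lambda>t. rep_germ c t / rep_germ d t)"
        | (large) "eventually_large (rep_germ z) (\<lambda>t. rep_germ c t / rep_germ d t)"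
        by (auto simp: separated_def)
      then show ?thesis
      proof cases
        case small
        show ?thesis
        proof (rule d_leads, rule Lim_null_comparison)
          show "((\<lambda>t. \<bar>rep_germ c t / rep_germ d t / rep_germ z t\<bar>) \<longlongrightarrow> 0) at_top"
            using small_ratio_tendsto_0[OF small z] by (rule tendsto_rabs_zero)
          have "\<forall>\<^sub>F t in at_top. rep_germ z t \<ge> 1"
            using z by (simp add: filterlim_at_top)
          then show "\<forall>\<^sub>F t in at_top. norm (rep_germ c t / rep_germ d t / rep_germ z t * (1 / rep_germ z t ^ i))
              \<le> \<bar>rep_germ c t / rep_germ d t / rep_germ z t\<bar>"
          proof eventually_elim
            case (elim t)
            then have "\<bar>1 / rep_germ z t ^ i\<bar> \<le> 1"
              by (simp add: divide_le_eq)
            then show ?case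
              unfolding real_norm_def abs_mult by (rule mult_left_le) simp
          qed
        qed
      next
        case large
        have cnz: "\<forall>\<^sub>F t in at_top. rep_germ c t \<noteq> 0"
          using nz c False by (simp add: eventually_nonzero_def)
        have "((\<lambda>t. 1 + rep_germ Q t / (rep_germ d t * rep_germ z t ^ i) *
            (rep_germ z t ^ Suc i / (rep_germ c t / rep_germ d t))) \<longlongrightarrow> 1 + 1 * 0) at_top"
          by (intro tendsto_intros lim power_ratio_large_tendsto_0[OF large z])
        moreover have "\<forall>\<^sub>F t in at_top. 1 + rep_germ Q t / (rep_germ d t * rep_germ z t ^ i) *
            (rep_germ z t ^ Suc i / (rep_germ c t / rep_germ d t)) =
            rep_germ (c + z * Q) t / (rep_germ c t * rep_germ z t ^ 0)"
          using rep_eq dnz cnz zpos by eventually_elim (simp add: field_simps)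
        ultimately have "((\<lambda>t. rep_germ (c + z * Q) t / (rep_germ c t * rep_germ z t ^ 0)) \<longlongrightarrow> 1 + 1 * 0) at_top"
          by (rule Lim_transform_eventually)
        then show ?thesis
          using c False unfolding eq mult_zero_right add_0_right by blast
      qed
    qed
  qed
qed

text \<open>The two quotients lie between 1/2 and 2, so their ratio lies between 1/4 and 4; one
  additional factor \<open>z \<ge> 4\<close> absorbs it.\<close>

lemma leading_term_ratio_bounds:
  fixes F G D E z :: real
  assumes F: "1 / 2 < F / (D * z ^ i)" "F / (D * z ^ i) < 2"
    and G: "1 / 2 < G / (E * z ^ j)" "G / (E * z ^ j) < 2" and z: "z \<ge> 4"
  shows "\<bar>F / G\<bar> \<le> \<bar>D / E\<bar> * z ^ Suc i" and "\<bar>D / E\<bar> \<le> \<bar>F / G\<bar> * z ^ Suc j"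
proof -
  define r s where "r = F / (D * z ^ i)" and "s = G / (E * z ^ j)"
  have nz: "D \<noteq> 0" "E \<noteq> 0"
    using F G by auto
  have zp: "z > 0" "z ^ i \<ge> 1" "z ^ j \<ge> 1"
    using z by auto
  have FG: "F = r * (D * z ^ i)" "G = s * (E * z ^ j)"
    using nz zp by (auto simp: r_def s_def)
  have r: "1 / 2 < r" "r < 2" and s: "1 / 2 < s" "s < 2"
    using F G by (auto simp: r_def s_def)
  have eq: "\<bar>F / G\<bar> = r / s * (z ^ i / z ^ j) * \<bar>D / E\<bar>"
    using nz zp r s by (simp add: FG abs_mult abs_divide mult_ac)
  have rs: "r / s \<le> z" "1 \<le> r / s * z"
  proof -
    have "4 * (1 / 2) \<le> z * s"
      using s z by (intro mult_mono) auto
    then have "r \<le> z * s"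
      using r by linarith
    then show "r / s \<le> z"
      using s by (simp add: divide_le_eq)
    have "(1 / 2) * 4 \<le> r * z"
      using r z by (intro mult_mono) auto
    then have "s \<le> r * z"
      using s by linarith
    then show "1 \<le> r / s * z"
      using s by (simp add: le_divide_eq)
  qed
  have "r / s * (z ^ i / z ^ j) \<le> z * (z ^ i / 1)"
    using rs zp r s by (intro mult_mono divide_left_mono) auto
  then show "\<bar>F / G\<bar> \<le> \<bar>D / E\<bar> * z ^ Suc i"
    unfolding eq by (subst mult.commute) (intro mult_left_mono, auto)
  have "1 * 1 \<le> (r / s * z) * z ^ i"
    using rs zp by (intro mult_mono) auto
  also have "\<dots> = r / s * (z ^ i / z ^ j) * z ^ Suc j"
    using zp by simp
  finally have "1 * \<bar>D / E\<bar> \<le> r / s * (z ^ i / z ^ j) * z ^ Suc j * \<bar>D / E\<bar>"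
    by (intro mult_right_mono) auto
  then show "\<bar>D / E\<bar> \<le> \<bar>F / G\<bar> * z ^ Suc j"
    unfolding eq by (simp only: mult_1_left mult_ac)
qed

text \<open>\<open>F / G\<close> and \<open>D / E\<close> bound each other up to powers of
  \<open>z\<close>, and these are invisible to \<open>w\<close>.\<close>

lemma separated_by_leading_terms:
  assumes F: "((\<lambda>t. F t / (D t * z t ^ i)) \<longlongrightarrow> 1) at_top"
    and G: "((\<lambda>t. G t / (E t * z t ^ j)) \<longlongrightarrow> 1) at_top"
    and z: "filterlim z at_top at_top" and zw: "\<And>p. \<forall>\<^sub>F t in at_top. z t ^ p < w t"
    and sep: "separated w (\<lambda>t. D t / E t)"
  shows "separated w (\<lambda>t. F t / G t)"
proof -
  have half: "1 / 2 < (1::real)" and two: "(1::real) < 2"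
    by simp_all
  have "\<forall>\<^sub>F t in at_top. z t \<ge> 4"
    using z by (simp add: filterlim_at_top)
  then have bounds: "\<forall>\<^sub>F t in at_top. \<bar>F t / G t\<bar> \<le> \<bar>D t / E t\<bar> * z t ^ Suc i \<and>
      \<bar>D t / E t\<bar> \<le> \<bar>F t / G t\<bar> * z t ^ Suc j \<and> z t \<ge> 4"
    using order_tendstoD(1)[OF F half] order_tendstoD(2)[OF F two]
      order_tendstoD(1)[OF G half] order_tendstoD(2)[OF G two]
    by eventually_elim (use leading_term_ratio_bounds in blast)
  consider (small) "eventually_small w (\<lambda>t. D t / E t)" | (large) "eventually_large w (\<lambda>t. D t / E t)"
    using sep by (auto simp: separated_def)
  then show ?thesis
  proof cases
    case small
    have "eventually_small w (\<lambda>t. F t / G t)"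
      unfolding eventually_small_def
    proof
      fix p
      \<comment> \<open>Doubled exponents put both squares \<open>u\<^sup>2\<close> and
        \<open>v\<^sup>2\<close> below \<open>w\<close>; then \<open>u * v\<close> is at most their
        mean.\<close>
      have "\<forall>\<^sub>F t in at_top. \<bar>D t / E t\<bar> ^ (p * 2) < w t"
        using small unfolding eventually_small_def by blast
      then show "\<forall>\<^sub>F t in at_top. \<bar>F t / G t\<bar> ^ p < w t"
        using bounds zw[of "Suc i * p * 2"]
      proof eventually_elim
        case (elim t)
        define u v where "u = \<bar>D t / E t\<bar> ^ p" and "v = z t ^ (Suc i * p)"
        have uv: "u\<^sup>2 < w t" "v\<^sup>2 < w t"
          unfolding u_def v_def power_mult[symmetric] using elim by blast+
        have "\<bar>F t / G t\<bar> ^ p \<le> (\<bar>D t / E t\<bar> * z t ^ Suc i) ^ p"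
          using elim by (intro power_mono) auto
        also have "\<dots> = u * v"
          by (simp only: u_def v_def power_mult_distrib power_mult)
        also have "u * v < w t"
        proof -
          have "2 * (u * v) \<le> u\<^sup>2 + v\<^sup>2"
            using sum_squares_bound[of u v] by simp
          then show ?thesis using uv by linarith
        qed
        finally show ?case .
      qed
    qed
    then show ?thesis by (simp add: separated_def)
  next
    case large
    have "eventually_large w (\<lambda>t. F t / G t)"
      unfolding eventually_large_def
    proof
      fix p
      \<comment> \<open>The spare factor \<open>w\<close> pays for \<open>z ^ Suc j\<close>.\<close>
      have "\<forall>\<^sub>F t in at_top. w t ^ Suc p < \<bar>D t / E t\<bar>"
        using large unfolding eventually_large_def by blast
      then show "\<forall>\<^sub>F t in at_top. w t ^ p < \<bar>F t / G t\<bar>"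
        using bounds zw[of "Suc j"]
      proof eventually_elim
        case (elim t)
        have "z t ^ Suc j > 0"
          using elim by simp
        then have "w t > 0"
          using elim by linarith
        have "w t * w t ^ p < \<bar>F t / G t\<bar> * z t ^ Suc j"
          using elim by simp
        also have "\<dots> \<le> w t * \<bar>F t / G t\<bar>"
          using elim by (subst mult.commute) (intro mult_right_mono, auto)
        finally show ?case
          using mult_less_cancel_left_pos[OF \<open>w t > 0\<close>] by blast
      qed
    qed
    then show ?thesis by (simp add: separated_def)
  qed
qed

lemma adjoin_leading_term:
  assumes "subring_of_germs R" and "eventually_nonzero R" and "separates_ratios R z"
    and "filterlim (rep_germ z) at_top at_top" and "f \<in> adjoin R z - {0}"
  shows "\<exists>d\<in>R - {0}. \<exists>i. ((\<lambda>t. rep_germ f t / (rep_germ d t * rep_germ z t ^ i)) \<longlongrightarrow> 1) at_top"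
proof -
  obtain p where "f = poly p z" "\<And>i. coeff p i \<in> R"
    using assms(5) by (auto simp: adjoin_def)
  then show ?thesis
    using leading_term[OF assms(1-4), of p] assms(5) by auto
qed

lemma eventually_nonzero_adjoin:
  assumes "subring_of_germs R" and "eventually_nonzero R" and "separates_ratios R z"
    and "filterlim (rep_germ z) at_top at_top"
  shows "eventually_nonzero (adjoin R z)"
  unfolding eventually_nonzero_def
proof
  fix f assume "f \<in> adjoin R z - {0}"
  then obtain d i where "((\<lambda>t. rep_germ f t / (rep_germ d t * rep_germ z t ^ i)) \<longlongrightarrow> 1) at_top"
    using adjoin_leading_term[OF assms] by blast
  then have "\<forall>\<^sub>F t in at_top. 0 < rep_germ f t / (rep_germ d t * rep_germ z t ^ i)"
    by (rule order_tendstoD) simp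
  then show "\<forall>\<^sub>F t in at_top. rep_germ f t \<noteq> 0"
    by eventually_elim auto
qed

lemma separates_ratios_adjoin:
  assumes R: "subring_of_germs R" "eventually_nonzero R" "separates_ratios R z"
    "filterlim (rep_germ z) at_top at_top"
    and w: "separates_ratios R w" "\<And>p. \<forall>\<^sub>F t in at_top. rep_germ z t ^ p < rep_germ w t"
  shows "separates_ratios (adjoin R z) w"
  unfolding separates_ratios_def
proof (intro ballI)
  fix f g assume "f \<in> adjoin R z - {0}" "g \<in> adjoin R z - {0}"
  then obtain d i e j where d: "d \<in> R - {0}" "e \<in> R - {0}"
    and lim: "((\<lambda>t. rep_germ f t / (rep_germ d t * rep_germ z t ^ i)) \<longlongrightarrow> 1) at_top"
      "((\<lambda>t. rep_germ g t / (rep_germ e t * rep_germ z t ^ j)) \<longlongrightarrow> 1) at_top"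
    using adjoin_leading_term[OF R] by meson
  have "separated (rep_germ w) (\<lambda>t. rep_germ d t / rep_germ e t)"
    using w(1) d by (simp add: separates_ratios_def)
  then show "separated (rep_germ w) (\<lambda>t. rep_germ f t / rep_germ g t)"
    by (rule separated_by_leading_terms[OF lim R(4) w(2)])
qed

section \<open>Differentiation of germs and rings of fractions\<close>

lemma germ_deriv_const: "germ_differentiable (germ_const r)" "germ_deriv (germ_const r) = 0"
  by (transfer, simp)+

lemma germ_deriv_add:
  assumes "germ_differentiable f" and "germ_differentiable g"
  shows "germ_differentiable (f + g)" and "germ_deriv (f + g) = germ_deriv f + germ_deriv g"
proof -
  show "germ_differentiable (f + g)"
    using assms by transfer (auto elim: eventually_elim2)
  show "germ_deriv (f + g) = germ_deriv f + germ_deriv g"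
    using assms
  proof transfer
    fix f g :: "real \<Rightarrow> real"
    assume "\<forall>\<^sub>F t in at_top. f differentiable at t" "\<forall>\<^sub>F t in at_top. g differentiable at t"
    then show "\<forall>\<^sub>F t in at_top. deriv (\<lambda>t. f t + g t) t = deriv f t + deriv g t"
      by eventually_elim (auto intro!: DERIV_imp_deriv DERIV_add simp: DERIV_deriv_iff_real_differentiable)
  qed
qed

lemma germ_deriv_mult:
  assumes "germ_differentiable f" and "germ_differentiable g"
  shows "germ_differentiable (f * g)" and "germ_deriv (f * g) = germ_deriv f * g + f * germ_deriv g"
proof -
  show "germ_differentiable (f * g)"
    using assms by transfer (auto elim: eventually_elim2)
  show "germ_deriv (f * g) = germ_deriv f * g + f * germ_deriv g"
    using assms
  proof transfer
    fix f g :: "real \<Rightarrow> real"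
    assume "\<forall>\<^sub>F t in at_top. f differentiable at t" "\<forall>\<^sub>F t in at_top. g differentiable at t"
    then show "\<forall>\<^sub>F t in at_top. deriv (\<lambda>t. f t * g t) t = deriv f t * g t + f t * deriv g t"
    proof eventually_elim
      case (elim t)
      then have "(f has_real_derivative deriv f t) (at t)" "(g has_real_derivative deriv g t) (at t)"
        by (simp_all add: DERIV_deriv_iff_real_differentiable)
      from DERIV_mult[OF this] show ?case
        by (intro DERIV_imp_deriv) (simp add: algebra_simps)
    qed
  qed
qed

lemma germ_deriv_inverse:
  assumes "germ_differentiable g" and "g * w = 1"
  shows "germ_differentiable w" and "germ_deriv w = - (germ_deriv g * (w * w))"
proof -
  have *: "\<forall>\<^sub>F t in at_top. (w has_real_derivative - (deriv g t * (w t * w t))) (at t)"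
    if "\<forall>\<^sub>F t in at_top. g differentiable at t" "\<forall>\<^sub>F t in at_top. g t * w t = 1"
    for g w :: "real \<Rightarrow> real"
    using that eventually_at_top_nhds[OF that(2)]
  proof eventually_elim
    case (elim t)
    have inv: "\<forall>\<^sub>F s in nhds t. inverse (g s) = w s"
      using elim(3) by eventually_elim (rule inverse_unique)
    have "((\<lambda>s. inverse (g s)) has_real_derivative - (inverse (g t) * deriv g t * inverse (g t))) (at t)"
      using elim by (intro DERIV_inverse') (auto simp: DERIV_deriv_iff_real_differentiable)
    then have "(w has_real_derivative - (inverse (g t) * deriv g t * inverse (g t))) (at t)"
      using has_field_derivative_cong_nhds[OF inv] by blast
    moreover have "inverse (g t) = w t"
      using elim(2) by (rule inverse_unique)
    ultimately show ?case
      by (simp only: mult_ac)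
  qed
  show "germ_differentiable w"
    using assms
  proof transfer
    fix g w :: "real \<Rightarrow> real"
    assume "\<forall>\<^sub>F t in at_top. g differentiable at t" "\<forall>\<^sub>F t in at_top. g t * w t = 1"
    from *[OF this] show "\<forall>\<^sub>F t in at_top. w differentiable at t"
      by eventually_elim (auto simp: real_differentiable_def)
  qed
  show "germ_deriv w = - (germ_deriv g * (w * w))"
    using assms
  proof transfer
    fix g w :: "real \<Rightarrow> real"
    assume "\<forall>\<^sub>F t in at_top. g differentiable at t" "\<forall>\<^sub>F t in at_top. g t * w t = 1"
    from *[OF this] show "\<forall>\<^sub>F t in at_top. deriv w t = - (deriv g t * (w t * w t))"
      by eventually_elim (rule DERIV_imp_deriv)
  qed
qed

text \<open>Nonzero elements of \<open>R\<close> are units among the germs, so fractions exist, and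
  the quotient rule keeps derivatives among them.\<close>

lemma hardy_field_fractions:
  assumes R: "subring_of_germs R" and nz: "eventually_nonzero R"
    and diff: "\<And>f. f \<in> R \<Longrightarrow> germ_differentiable f" "\<And>f. f \<in> R \<Longrightarrow> germ_deriv f \<in> R"
  shows "\<exists>K. hardy_field K \<and> R \<subseteq> K"
proof -
  note RD = subring_of_germsD[OF R]
  \<comment> \<open>Division is encoded by a germ \<open>w\<close> inverse to the denominator
    \<open>g\<close>, as the ring of all germs is not a field.\<close>
  define K where "K = {f * w | f w. f \<in> R \<and> (\<exists>g\<in>R. g * w = 1)}"
  have KI: "f * w \<in> K" if "f \<in> R" "g \<in> R" "g * w = 1" for f g w
    using that unfolding K_def by blast
  have RK: "R \<subseteq> K"
    using KI[of _ 1 1] RD by auto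
  have inverse: "\<exists>v. f * v = 1" if "f \<in> R" "f \<noteq> 0" for f
  proof -
    have "\<forall>\<^sub>F t in at_top. rep_germ f t \<noteq> 0"
      using nz that by (simp add: eventually_nonzero_def)
    then have "\<forall>\<^sub>F t in at_top. rep_germ f t * inverse (rep_germ f t) = 1"
      by eventually_elim simp
    then have "germ_of (rep_germ f) * germ_of (\<lambda>t. inverse (rep_germ f t)) = 1"
      unfolding times_germ.abs_eq one_germ_def by (simp add: germ_of_eq_iff)
    then show ?thesis by auto
  qed
  have "subfield_of_germs K"
    unfolding subfield_of_germs_def
  proof (intro conjI ballI impI)
    show "0 \<in> K" "1 \<in> K"
      using RK RD by auto
    fix x assume "x \<in> K"
    then obtain f w g where x: "x = f * w" "f \<in> R" "g \<in> R" "g * w = 1"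
      by (auto simp: K_def)
    show "- x \<in> K"
      using KI[of "- f" g w] x RD by simp
    show "\<exists>y\<in>K. x * y = 1" if "x \<noteq> 0"
    proof -
      have "f \<noteq> 0"
        using that x by auto
      then obtain v where v: "f * v = 1"
        using inverse x by blast
      have "f * w * (g * v) = (f * v) * (g * w)"
        by (simp only: ac_simps)
      then have "x * (g * v) = 1"
        using x v by simp
      then show ?thesis
        using KI[of g f v] x v by blast
    qed
    fix y assume "y \<in> K"
    then obtain f' w' g' where y: "y = f' * w'" "f' \<in> R" "g' \<in> R" "g' * w' = 1"
      by (auto simp: K_def)
    have gg: "(g * g') * (w * w') = 1"
    proof -
      have "(g * g') * (w * w') = (g * w) * (g' * w')"
        by (simp only: ac_simps)
      then show ?thesis using x y by simp
    qed
    have "(f * g' + f' * g) * (w * w') = (f * w) * (g' * w') + (f' * w') * (g * w)"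
      by (simp add: algebra_simps)
    then have "x + y = (f * g' + f' * g) * (w * w')"
      using x y by simp
    then show "x + y \<in> K"
      using KI[OF _ _ gg] x y RD by auto
    have "x * y = (f * f') * (w * w')"
      using x y by (simp add: ac_simps)
    moreover have "(f * f') * (w * w') \<in> K"
      by (rule KI[OF RD(4)[OF x(2) y(2)] RD(4)[OF x(3) y(3)] gg])
    ultimately show "x * y \<in> K"
      by (simp only:)
  qed
  moreover have "germ_differentiable x \<and> germ_deriv x \<in> K" if xK: "x \<in> K" for x
  proof -
    obtain f w g where x: "x = f * w" "f \<in> R" "g \<in> R" "g * w = 1"
      using xK by (auto simp: K_def)
    note w = germ_deriv_inverse[OF diff(1)[OF x(3)] x(4)]
    note fw = germ_deriv_mult[OF diff(1)[OF x(2)] w(1)]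
    have gg: "(g * g) * (w * w) = 1"
    proof -
      have "(g * g) * (w * w) = (g * w) * (g * w)"
        by (simp only: ac_simps)
      then show ?thesis using x by simp
    qed
    \<comment> \<open>The factor \<open>g * w = 1\<close> is inserted to bring both terms over the
      denominator \<open>g * g\<close>.\<close>
    have "germ_deriv x = germ_deriv f * w * (g * w) - f * (germ_deriv g * (w * w))"
      unfolding x(1) fw(2) w(2) x(4) by simp
    also have "\<dots> = (germ_deriv f * g - f * germ_deriv g) * (w * w)"
      by (simp add: algebra_simps)
    also have "\<dots> \<in> K"
      using KI[OF _ _ gg] x RD diff subring_of_germs_diff[OF R] by auto
    finally show ?thesis
      using fw(1) x by simp
  qed
  ultimately have "hardy_field K"
    unfolding hardy_field_def by blast
  then show ?thesis using RK by blast
qed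

text \<open>\<open>z (n - 1)\<close> is adjoined first and \<open>z i\<close> last. Since
  \<open>z k\<close> outgrows \<open>z (Suc k)\<close>, this is the order of increasing
  growth.\<close>

definition tower :: "germ set \<Rightarrow> (nat \<Rightarrow> germ) \<Rightarrow> nat \<Rightarrow> nat \<Rightarrow> germ set" where
  "tower R z i n = foldr (\<lambda>k S. adjoin S (z k)) [i..<n] R"

lemma tower_self [simp]: "tower R z n n = R"
  by (simp add: tower_def)

lemma tower_step: "i < n \<Longrightarrow> tower R z i n = adjoin (tower R z (Suc i) n) (z i)"
  by (simp add: tower_def upt_conv_Cons)

lemma foldr_adjoin_mono: "R \<subseteq> S \<Longrightarrow> foldr (\<lambda>k S. adjoin S (z k)) ks R \<subseteq> foldr (\<lambda>k S. adjoin S (z k)) ks S"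
  by (induction ks) (simp_all add: adjoin_mono)

lemma subring_tower:
  assumes "subring_of_germs R" "i \<le> n"
  shows "subring_of_germs (tower R z i n)"
  using assms(2) by (induction i rule: inc_induct) (auto simp: assms(1) tower_step intro: subring_adjoin)

text \<open>The additional generator \<open>z k\<close> enters at the innermost level: it enlarges
  the base ring from \<open>R\<close> to \<open>adjoin R (z k)\<close>.\<close>

lemma tower_mono_right:
  assumes "subring_of_germs R" and "n \<le> n'"
  shows "tower R z 0 n \<subseteq> tower R z 0 n'"
proof -
  have "tower R z 0 k \<subseteq> tower R z 0 (Suc k)" for k
    unfolding tower_def using foldr_adjoin_mono[OF subset_adjoin[OF assms(1)]] by simp
  then show ?thesis
    using lift_Suc_mono_le[of "tower R z 0"] assms(2) by blast
qed

lemma tower_subset_0: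
  assumes "subring_of_germs R" and "i \<le> n"
  shows "tower R z i n \<subseteq> tower R z 0 n"
  using assms(2)
proof (induction i)
  case (Suc i)
  then show ?case
    using subset_adjoin[OF subring_tower[OF assms(1) Suc.prems], of z "z i"] tower_step[of i n R z] by auto
qed simp

text \<open>The generators are adjoined in increasing order of growth; each one dominates all powers of
  the previous ones, so every element of the tower is asymptotic to \<open>d * z i ^ k\<close>, \<open>d\<close> from the
  preceding ring.\<close>

lemma hardy_field_of_generators:
  assumes R: "subring_of_germs R" and nz: "eventually_nonzero R"
    and diff: "\<And>f. f \<in> R \<Longrightarrow> germ_differentiable f" "\<And>f. f \<in> R \<Longrightarrow> germ_deriv f \<in> R"
    and sep: "\<And>k. separates_ratios R (z k)"
    and z_top: "\<And>k. filterlim (rep_germ (z k)) at_top at_top"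
    and dom: "\<And>k l p. l < k \<Longrightarrow> \<forall>\<^sub>F t in at_top. rep_germ (z k) t ^ p < rep_germ (z l) t"
    and e: "e \<in> R"
    and z_diff: "\<And>k. germ_differentiable (z k)" "\<And>k. germ_deriv (z k) = z k * z (Suc k) * e"
  shows "\<exists>K. hardy_field K \<and> R \<subseteq> K \<and> z 0 \<in> K"
proof -
  \<comment> \<open>The induction has to carry separation with respect to all generators still to be
    adjoined, those with index below \<open>i\<close>.\<close>
  have T: "eventually_nonzero (tower R z i n) \<and> (\<forall>l<i. separates_ratios (tower R z i n) (z l))"
    if "i \<le> n" for i n
    using that
  proof (induction i rule: inc_induct)
    case base
    show ?case using nz sep by simp
  next
    case (step i)
    have ring: "subring_of_germs (tower R z (Suc i) n)"
      using subring_tower[OF R] step.hyps by simp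
    show ?case
      unfolding tower_step[OF step.hyps(2)]
      using eventually_nonzero_adjoin[OF ring _ _ z_top]
        separates_ratios_adjoin[OF ring _ _ z_top _ dom] step.IH by simp
  qed
  \<comment> \<open>The derivative of \<open>z k\<close> involves \<open>z (Suc k)\<close>, so
    closure under derivation is obtained for the union of the towers.\<close>
  define S where "S = (\<Union>n. tower R z 0 n)"
  have sub_S: "tower R z i n \<subseteq> S" if "i \<le> n" for i n
    using tower_subset_0[OF R that] unfolding S_def by blast
  have common: "\<exists>n. f \<in> tower R z 0 n \<and> g \<in> tower R z 0 n" if fg: "f \<in> S" "g \<in> S" for f g
  proof -
    obtain m n where "f \<in> tower R z 0 m" "g \<in> tower R z 0 n"
      using fg by (auto simp: S_def)
    then show ?thesis
      using tower_mono_right[OF R, of m "max m n" z] tower_mono_right[OF R, of n "max m n" z]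
      by (intro exI[of _ "max m n"]) auto
  qed
  have RS: "R \<subseteq> S"
    using sub_S[of 0 0] by simp
  have ring_S: "subring_of_germs S"
    unfolding subring_of_germs_def
  proof (intro conjI ballI)
    show "0 \<in> S" "1 \<in> S"
      using RS subring_of_germsD[OF R] by auto
    fix f assume f: "f \<in> S"
    then obtain n where "f \<in> tower R z 0 n"
      by (auto simp: S_def)
    then show "- f \<in> S"
      using subring_of_germsD(5)[OF subring_tower[OF R, of 0 n z]] by (auto simp: S_def)
    fix g assume "g \<in> S"
    then obtain n where "f \<in> tower R z 0 n" "g \<in> tower R z 0 n"
      using common[OF f] by blast
    then show "f + g \<in> S" "f * g \<in> S"
      using subring_of_germsD(3,4)[OF subring_tower[OF R, of 0 n z]] unfolding S_def by blast+
  qed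
  note SD = subring_of_germsD[OF ring_S]
  have z_S: "z k \<in> S" for k
  proof -
    have "z k \<in> tower R z k (Suc k)"
      using generator_in_adjoin[OF R] by (simp add: tower_step)
    then show ?thesis
      using sub_S[of k "Suc k"] by auto
  qed
  have deriv_z: "germ_deriv (z k) \<in> S" for k
    using z_diff(2) z_S e RS SD(4) by auto
  have "\<forall>f\<in>tower R z i n. germ_differentiable f \<and> germ_deriv f \<in> S" if "i \<le> n" for i n
    using that
  proof (induction i rule: inc_induct)
    case base
    show ?case using diff RS by auto
  next
    case (step i)
    show ?case
    proof
      fix f assume "f \<in> tower R z i n"
      then obtain p where p: "f = poly p (z i)" "\<And>j. coeff p j \<in> tower R z (Suc i) n"
        by (auto simp: tower_step[OF step.hyps(2)] adjoin_def)
      \<comment> \<open>Membership in \<open>S\<close> is part of the induction, since the product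
        rule multiplies the polynomial by the derivative of \<open>z i\<close>.\<close>
      have "poly p (z i) \<in> S \<and> germ_differentiable (poly p (z i)) \<and> germ_deriv (poly p (z i)) \<in> S"
        using p(2)
      proof (induction p)
        case 0
        show ?case
          using germ_deriv_const[of 0] SD(1) by (simp add: zero_germ_def germ_const.abs_eq)
      next
        case (pCons c p)
        have c: "c \<in> tower R z (Suc i) n" and p: "\<And>j. coeff p j \<in> tower R z (Suc i) n"
          using pCons.prems[of 0] pCons.prems[of "Suc j" for j] by auto
        note c' = step.IH[rule_format, OF c]
        note p' = pCons.IH[OF p]
        have cS: "c \<in> S"
          using c sub_S[of "Suc i" n] step.hyps by auto
        note zp = germ_deriv_mult[OF z_diff(1)[of i], of "poly p (z i)"]
        note all = germ_deriv_add[of c "z i * poly p (z i)"]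
        show ?case
          using c' p' cS zp all SD z_S deriv_z by simp
      qed
      then show "germ_differentiable f \<and> germ_deriv f \<in> S"
        using p(1) by simp
    qed
  qed
  then have diff_S: "germ_differentiable f" "germ_deriv f \<in> S" if "f \<in> S" for f
    using that by (auto simp: S_def)
  have "eventually_nonzero S"
    using T[of 0] unfolding eventually_nonzero_def S_def by auto
  then obtain K where "hardy_field K" "S \<subseteq> K"
    using hardy_field_fractions[OF ring_S _ diff_S] by blast
  then show ?thesis
    using RS z_S by blast
qed

text \<open>All iterated derivatives stay in \<open>K\<close>. Finitely many of them are
  differentiable on a common half-line, which depends on \<open>n\<close>.\<close>

lemma hardy_field_subset_germs_C_less_infinity:
  assumes "hardy_field K"
  shows "K \<subseteq> germs_C_less_infinity"
proof
  fix y assume y: "y \<in> K"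
  define f where "f = rep_germ y"
  have K: "germ_of ((deriv ^^ k) f) \<in> K" for k
  proof (induction k)
    case (Suc k)
    then have "germ_deriv (germ_of ((deriv ^^ k) f)) \<in> K"
      using assms by (simp add: hardy_field_def)
    then show ?case by (simp add: germ_deriv.abs_eq)
  qed (simp add: f_def y)
  have ev: "\<forall>\<^sub>F t in at_top. (deriv ^^ k) f differentiable at t" for k
    using assms K[of k] unfolding hardy_field_def germ_differentiable.abs_eq[symmetric] by blast
  have "y \<in> germs_Cn n" for n
  proof -
    have "\<forall>\<^sub>F t in at_top. \<forall>k\<in>{..n}. (deriv ^^ k) f differentiable at t"
      using ev by (intro eventually_ball_finite) auto
    then obtain a where a: "\<And>t k. t > a \<Longrightarrow> k \<le> n \<Longrightarrow> (deriv ^^ k) f differentiable at t"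
      unfolding eventually_at_top_dense by auto
    have "continuous_on {a<..} ((deriv ^^ n) f)"
      using a by (intro continuous_at_imp_continuous_on) (auto intro: differentiable_imp_continuous_within)
    then have "Cn_on n f {a<..}"
      unfolding Cn_on_def using a by auto
    moreover have "y = germ_of f"
      by (simp add: f_def)
    ultimately show ?thesis
      unfolding germs_Cn_def by blast
  qed
  then show "y \<in> germs_C_less_infinity"
    by (simp add: germs_C_less_infinity_def)
qed

section \<open>The hardian germ\<close>

context liouville_hardy_field
begin

lemma subring: "subring_of_germs H"
  using subfield by (auto simp: subfield_of_germs_def subring_of_germs_def)

lemma eventually_nonzero_H: "eventually_nonzero H"
  unfolding eventually_nonzero_def
proof
  fix c assume "c \<in> H - {0}"
  then have "inH (rep_germ c)" and "\<not> (\<forall>\<^sub>F t in at_top. rep_germ c t = 0)"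
    using germ_of_eq_iff[of "rep_germ c" "\<lambda>_. 0"] by (auto simp: zero_germ_def)
  then obtain g where "\<forall>\<^sub>F t in at_top. rep_germ c t * g t = 1"
    using inH_zero_or_inverse by blast
  then show "\<forall>\<^sub>F t in at_top. rep_germ c t \<noteq> 0"
    by eventually_elim auto
qed

lemma inH_abs:
  assumes "inH f"
  shows "inH (\<lambda>t. \<bar>f t\<bar>)"
proof -
  consider "\<forall>\<^sub>F t in at_top. f t < 0" | "\<forall>\<^sub>F t in at_top. 0 \<le> f t"
    using inH_less_or_ge[OF assms inH_const[of 0]] by blast
  then show ?thesis
  proof cases
    case 1
    then have "\<forall>\<^sub>F t in at_top. - f t = \<bar>f t\<bar>"
      by eventually_elim simp
    then show ?thesis
      by (rule inH_cong[OF inH_minus[OF assms]])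
  next
    case 2
    then have "\<forall>\<^sub>F t in at_top. f t = \<bar>f t\<bar>"
      by eventually_elim simp
    then show ?thesis
      by (rule inH_cong[OF assms])
  qed
qed

end

section \<open>The Hardy field generated by the solution\<close>

context countable_wide_gap_field
begin

lemma hardian_in_gap_exists:
  "\<exists>y\<in>germs_C_less_infinity. (\<forall>f\<in>A. f <\<^sub>e y) \<and> (\<forall>f\<in>B. y <\<^sub>e f) \<and> hardian_over H y"
proof -
  obtain x where
    x_deriv: "\<And>k. \<forall>\<^sub>F s in at_top. (x k has_real_derivative exp (x (Suc k) s) * deriv \<phi> s) (at s)"
    and x_gt: "\<And>j k. \<forall>\<^sub>F s in at_top. a j s < x k s"
    and x_less: "\<And>j k. \<forall>\<^sub>F s in at_top. x k s < \<xi> j k s"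
    and x_dom: "\<And>k p. \<forall>\<^sub>F s in at_top. real p * x (Suc k) s \<le> x k s"
    using solution_exists by blast
  have x_top: "filterlim (x k) at_top at_top" for k
  proof (rule filterlim_at_top_mono[OF inA_at_top[OF inA_a[of 0]]])
    show "\<forall>\<^sub>F s in at_top. a 0 s \<le> x k s"
      using x_gt[of 0 k] by eventually_elim simp
  qed
  have x_pos: "\<forall>\<^sub>F s in at_top. x k s > 0" for k
    using x_top[of k] by (simp add: filterlim_at_top_dense)
  have x_antimono: "\<forall>\<^sub>F s in at_top. x k s \<le> x l s" if "l \<le> k" for k l
    using that
  proof (induction k rule: dec_induct)
    case (step k)
    show ?case
      using step.IH x_dom[of 1 k] by eventually_elim simp
  qed simp
  have x_gt_inA: "\<forall>\<^sub>F s in at_top. u s < x k s" if u: "inA u" for u k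
  proof -
    obtain j where "\<forall>\<^sub>F t in at_top. u t \<le> a j t"
      using cofinal_a[OF u] by blast
    then show ?thesis
      using x_gt[of j k] by eventually_elim simp
  qed
  \<comment> \<open>Since \<open>\<xi> j 0\<close> is the logarithm of \<open>b j\<close> and the
    components decrease with \<open>k\<close>, all of them lie below \<open>ln u\<close>.\<close>
  have x_less_ln: "\<forall>\<^sub>F s in at_top. x k s < ln (u s)" if u: "above u" for u k
  proof -
    obtain j where "\<forall>\<^sub>F t in at_top. b j t \<le> u t"
      using coinitial_b[OF u] by blast
    moreover have "\<forall>\<^sub>F t in at_top. b j t > 0"
      using above_at_top[OF above_b] by (simp add: filterlim_at_top_dense)
    moreover have "\<forall>\<^sub>F t in at_top. x k t < ln (b j t)"
      using x_less[where j = j and k = 0, unfolded \<xi>.simps] x_antimono[of 0 k, OF le0] by eventually_elim simp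
    ultimately show ?thesis
      by eventually_elim (smt (verit) ln_le_cancel_iff)
  qed
  define z where "z = (\<lambda>k. germ_of (\<lambda>t. exp (x k t)))"
  have rep_z: "\<forall>\<^sub>F t in at_top. rep_germ (z k) t = exp (x k t)" for k
    unfolding z_def by (rule rep_germ_of)
  \<comment> \<open>If \<open>\<bar>h\<bar>\<close> is above the gap, then
    \<open>p * x k \<le> p * ln (ln \<bar>h\<bar>) < ln \<bar>h\<bar>\<close>. Otherwise
    \<open>\<bar>h\<bar> \<le> u\<close> with \<open>u\<close> in \<open>A\<close>, and
    \<open>p * ln u < u < x k\<close>. Exponentiation gives the two alternatives.\<close>
  have separated: "separated (rep_germ (z k)) h" if h: "inH h" for h k
  proof (cases "above (\<lambda>t. \<bar>h t\<bar>)")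
    case True
    have "\<forall>\<^sub>F t in at_top. rep_germ (z k) t ^ p < \<bar>h t\<bar>" for p
    proof -
      have "\<forall>\<^sub>F t in at_top. \<bar>h t\<bar> > 0"
        using above_at_top[OF True] unfolding filterlim_at_top_dense by blast
      then show ?thesis
        using x_less_ln[OF above_ln[OF True], of k] above_ln_scaled[OF above_ln[OF True], of p] rep_z[of k]
      proof eventually_elim
        case (elim t)
        have "real p * x k t \<le> real p * ln (ln \<bar>h t\<bar>)"
          using elim by (intro mult_left_mono) auto
        then have "exp (real p * x k t) < exp (ln \<bar>h t\<bar>)"
          using elim by (simp only: exp_less_cancel_iff)
        also have "exp (ln \<bar>h t\<bar>) = \<bar>h t\<bar>"
          using elim by simp
        finally have "exp (real p * x k t) < \<bar>h t\<bar>" .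
        then show ?case
          using elim by (simp add: exp_of_nat_mult)
      qed
    qed
    then show ?thesis
      by (simp add: separated_def eventually_large_def)
  next
    case False
    then obtain u where u: "inA u" "\<forall>\<^sub>F t in at_top. \<bar>h t\<bar> \<le> u t"
      using not_aboveD[OF inH_abs[OF h]] by blast
    have "\<forall>\<^sub>F t in at_top. \<bar>h t\<bar> ^ p < rep_germ (z k) t" for p
    proof -
      have "\<forall>\<^sub>F t in at_top. real p * ln (u t) < u t"
        using eventually_compose_filterlim[OF eventually_scaled_ln_less inA_at_top[OF u(1)]] .
      moreover have "\<forall>\<^sub>F t in at_top. u t > 0"
        using inA_at_top[OF u(1)] by (simp add: filterlim_at_top_dense)
      ultimately show ?thesis
        using u(2) x_gt_inA[OF u(1), of k] rep_z[of k]
      proof eventually_elim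
        case (elim t)
        have "\<bar>h t\<bar> ^ p \<le> u t ^ p"
          using elim by (intro power_mono) auto
        also have "u t ^ p = exp (real p * ln (u t))"
          using elim by (simp add: exp_of_nat_mult)
        also have "\<dots> < exp (x k t)"
          using elim by simp
        finally show ?case
          using elim by simp
      qed
    qed
    then show ?thesis
      by (simp add: separated_def eventually_small_def)
  qed
  have "\<exists>K. hardy_field K \<and> H \<subseteq> K \<and> z 0 \<in> K"
  proof (rule hardy_field_of_generators[OF subring eventually_nonzero_H])
    show "germ_differentiable f" "germ_deriv f \<in> H" if "f \<in> H" for f
      using hardy that by (auto simp: hardy_field_def)
    show "separates_ratios H (z k)" for k
      unfolding separates_ratios_def
    proof (intro ballI)
      fix c d assume "c \<in> H - {0}" "d \<in> H - {0}"
      then have "inH (rep_germ c)" "inH (rep_germ d)"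
        by simp_all
      then show "separated (rep_germ (z k)) (\<lambda>t. rep_germ c t / rep_germ d t)"
        by (intro separated inH_divide)
    qed
    show "filterlim (rep_germ (z k)) at_top at_top" for k
    proof (rule filterlim_at_top_mono[OF x_top[of k]])
      show "\<forall>\<^sub>F t in at_top. x k t \<le> rep_germ (z k) t"
        using rep_z[of k] by eventually_elim (smt (verit) exp_ge_add_one_self)
    qed
    \<comment> \<open>The factor \<open>Suc p\<close> instead of \<open>p\<close> makes the
      inequality strict, as \<open>x k\<close> is positive.\<close>
    show "\<forall>\<^sub>F t in at_top. rep_germ (z k) t ^ p < rep_germ (z l) t" if "l < k" for k l p
      using x_dom[of "Suc p" l] x_antimono[OF Suc_leI[OF that]] x_pos[of k] rep_z[of k] rep_z[of l]
    proof eventually_elim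
      case (elim t)
      have "real p * x k t < real (Suc p) * x k t"
        using elim by simp
      also have "\<dots> \<le> real (Suc p) * x (Suc l) t"
        using elim by (intro mult_left_mono) auto
      finally have "exp (real p * x k t) < exp (x l t)"
        using elim by simp
      then show ?case
        using elim by (simp add: exp_of_nat_mult)
    qed
    show "germ_of (deriv \<phi>) \<in> H"
      using inH_deriv[OF inH_scale] by (simp add: inH_def)
    have z_deriv: "\<forall>\<^sub>F t in at_top. ((\<lambda>t. exp (x k t)) has_real_derivative
        exp (x k t) * exp (x (Suc k) t) * deriv \<phi> t) (at t)" for k
      using x_deriv[of k] by eventually_elim (auto intro!: derivative_eq_intros)
    show "germ_differentiable (z k)" for k
      unfolding z_def germ_differentiable.abs_eq
      using z_deriv[of k] by eventually_elim (auto simp: real_differentiable_def)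
    show "germ_deriv (z k) = z k * z (Suc k) * germ_of (deriv \<phi>)" for k
      unfolding z_def germ_deriv.abs_eq times_germ.abs_eq germ_of_eq_iff
      using z_deriv[of k] by eventually_elim (rule DERIV_imp_deriv)
  qed
  then obtain K where K: "hardy_field K" "H \<subseteq> K" "z 0 \<in> K"
    by blast
  have "f <\<^sub>e z 0" if "f \<in> A" for f
  proof -
    have "inA (rep_germ f)"
      using that by (simp add: inA_def)
    from x_gt_inA[OF this, of 0]
    have "\<forall>\<^sub>F t in at_top. rep_germ f t < exp (x 0 t)"
      by eventually_elim (smt (verit) exp_ge_add_one_self)
    then have "germ_of (rep_germ f) <\<^sub>e z 0"
      unfolding z_def germ_less.abs_eq .
    then show ?thesis by simp
  qed
  moreover have "z 0 <\<^sub>e f" if "f \<in> B" for f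
  proof -
    note f = inB_above[OF that]
    have "\<forall>\<^sub>F t in at_top. rep_germ f t > 0"
      using above_at_top[OF f] by (simp add: filterlim_at_top_dense)
    then have "\<forall>\<^sub>F t in at_top. exp (x 0 t) < rep_germ f t"
      using x_less_ln[OF f, of 0] by eventually_elim (smt (verit) exp_ln exp_less_mono)
    then have "z 0 <\<^sub>e germ_of (rep_germ f)"
      unfolding z_def germ_less.abs_eq .
    then show ?thesis by simp
  qed
  moreover have "hardian_over H (z 0)"
    using K unfolding hardian_over_def by blast
  ultimately show ?thesis
    using hardy_field_subset_germs_C_less_infinity[OF K(1)] K(3) by blast
qed

end

section \<open>From countable cofinality to sequences\<close>

lemma has_cofinality_natLeq_sequence:
  fixes S :: "'a set"
  assumes "has_cofinality le S natLeq" and "S \<noteq> {}"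
  shows "\<exists>f :: nat \<Rightarrow> 'a. range f \<subseteq> S \<and> (\<forall>s\<in>S. \<exists>n. le s (f n))"
proof -
  obtain C where C: "cofinal_subset le S C" "|C| =o natLeq"
    using assms(1) unfolding has_cofinality_def by blast
  have "countable C"
    using C(2) by (simp add: countable_card_le_natLeq ordIso_imp_ordLeq)
  moreover have "C \<noteq> {}"
    using C(1) assms(2) by (auto simp: cofinal_subset_def)
  ultimately have range: "range (from_nat_into C) = C"
    by (simp add: range_from_nat_into)
  have "\<exists>n. le s (from_nat_into C n)" if "s \<in> S" for s
  proof -
    have "\<exists>c\<in>range (from_nat_into C). le s c"
      using C(1) that by (simp add: range cofinal_subset_def)
    then show ?thesis by simp
  qed
  moreover have "range (from_nat_into C) \<subseteq> S"
    using C(1) by (simp add: range cofinal_subset_def)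
  ultimately show ?thesis by blast
qed

theorem theorem6p2:
  fixes H A B :: "germ set"
  assumes "hardy_field H"
    and "range germ_const \<subseteq> H"
    and "liouville_closed H"
    and "wide_gap H A B"
    and "has_cofinality (\<le>\<^sub>e) A natLeq"
    and "has_coinitiality (\<le>\<^sub>e) B natLeq"
  shows "\<exists>y\<in>germs_C_less_infinity.
           (\<forall>a\<in>A. a <\<^sub>e y) \<and> (\<forall>b\<in>B. y <\<^sub>e b) \<and> hardian_over H y"
proof -
  have nonempty: "A \<noteq> {}" "B \<noteq> {}"
    using assms(4) by (auto simp: wide_gap_def)
  obtain f :: "nat \<Rightarrow> germ" where f: "range f \<subseteq> A" "\<forall>s\<in>A. \<exists>n. s \<le>\<^sub>e f n"
    using has_cofinality_natLeq_sequence[OF assms(5) nonempty(1)] by blast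
  obtain g :: "nat \<Rightarrow> germ" where g: "range g \<subseteq> B" "\<forall>s\<in>B. \<exists>n. g n \<le>\<^sub>e s"
    using has_cofinality_natLeq_sequence[OF assms(6)[unfolded has_coinitiality_def] nonempty(2)]
    by blast
  \<comment> \<open>The scale may be any element of \<open>A\<close>; the first term of the cofinal
    sequence is taken.\<close>
  interpret wide_gap_field H A B "rep_germ (f 0)"
    using assms(1-4) f(1) by unfold_locales auto
  interpret countable_wide_gap_field H A B "rep_germ (f 0)" "\<lambda>n. rep_germ (f n)" "\<lambda>n. rep_germ (g n)"
  proof
    show "inA (rep_germ (f j))" for j
      using f(1) by (auto simp: inA_def)
    show "above (rep_germ (g j))" for j
      using g(1) by (intro inB_above) auto
    show "\<exists>j. \<forall>\<^sub>F t in at_top. u t \<le> rep_germ (f j) t" if u: "inA u" for u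
    proof -
      obtain j where "germ_of u \<le>\<^sub>e germ_of (rep_germ (f j))"
        using f(2) u by (auto simp: inA_def)
      then show ?thesis
        unfolding germ_le.abs_eq by blast
    qed
    \<comment> \<open>Coinitiality of \<open>g\<close> in \<open>B\<close> extends to the whole
      upper side of the cut because no element of \<open>H\<close> fills the gap.\<close>
    show "\<exists>j. \<forall>\<^sub>F t in at_top. rep_germ (g j) t \<le> u t" if u: "above u" for u
    proof -
      obtain b where b: "b \<in> B" "\<forall>\<^sub>F t in at_top. rep_germ b t \<le> u t"
        using above_ge_inB[OF u] by blast
      then obtain j where "germ_of (rep_germ (g j)) \<le>\<^sub>e germ_of (rep_germ b)"
        using g(2) by auto
      then have "\<forall>\<^sub>F t in at_top. rep_germ (g j) t \<le> rep_germ b t"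
        unfolding germ_le.abs_eq .
      then have "\<forall>\<^sub>F t in at_top. rep_germ (g j) t \<le> u t"
        using b(2) by eventually_elim simp
      then show ?thesis by blast
    qed
  qed
  show ?thesis
    by (rule hardian_in_gap_exists)
qed

end
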